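(* Let $\mathcal{H}$ be a real Hilbert space, let $V:\mathcal{H}\to\mathcal{H}$ be monotone and continuous, and let $x_*\in\mathcal{H}$ with $V(x_* )=0$. Let $t_0>0$, $\lambda>0$, let $\mu:[t_0,+\infty)\to(0,+\infty)$ be continuously differentiable and nondecreasing, and let $\gamma:[t_0,+\infty)\to(0,+\infty)$ be continuous, such that $$\lim_{t\to+\infty}\frac{\gamma(t)}{\mu(t)}=:L>0,\qquad \sup_{t\ge t_0}\frac{\dot\mu(t)}{\gamma(t)}<1,\qquad 2\lambda-3L+\inf_{t\ge t_0}\frac{\dot\mu(t)}{\mu(t)}>0 ,$$ the limit $L$ being a real number. Let $y:[t_0,+\infty)\to\mathcal{H}$ be a solution of $$\ddot y(t)+\lambda\dot y(t)+\mu(t)\frac{d}{dt}V(y(t))+\gamma(t)V(y(t))=0\quad\text{for } t\ge t_0 .$$ Then the following statements are true. (i) As $t\to+\infty$, $$\|V(y(t))\|=o\left(\frac1{\mu(t)}\right),\qquad\langle y(t)-x_*,V(y(t))\rangle=o\left(\frac1{\mu(t)}\right),\qquad\|\dot y(t)\|\to0 .$$ (ii) $y(t)$ converges weakly to a zero of $V$ as $t\to+\infty$.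
   Context: $V$ is monotone if $\langle V(y)-V(x),y-x\rangle\ge0$ for all $x,y\in\mathcal{H}$. A zero of $V$ is a point $z\in\mathcal{H}$ with $V(z)=0$. A solution is a function $y:[t_0,+\infty)\to\mathcal{H}$ such that $y$, $\dot y$ and $t\mapsto V(y(t))$ are absolutely continuous on each interval $[t_0,t_1]$ and the equation holds for almost every $t\ge t_0$. *)

theory Defs
  imports "HOL-Analysis.Analysis" "HOL-Library.Landau_Symbols"
begin

definition monotone_operator :: "('a::real_inner \<Rightarrow> 'a) \<Rightarrow> bool" where
  "monotone_operator V \<longleftrightarrow> (\<forall>x y. (V y - V x) \<bullet> (y - x) \<ge> 0)"

(* A pair (u, v) in D stands for the interval {u..v}; degenerate pairs are harmless.
   The constant absolutely_continuous of HOL-Analysis is the unrelated notion for measures. *)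
definition absolutely_continuous_on :: "real set \<Rightarrow> (real \<Rightarrow> 'a::real_normed_vector) \<Rightarrow> bool" where
  "absolutely_continuous_on I f \<longleftrightarrow>
    (\<forall>\<epsilon>>0. \<exists>\<delta>>0. \<forall>D. finite D
        \<and> (\<forall>(u, v)\<in>D. u \<le> v \<and> {u..v} \<subseteq> I)
        \<and> pairwise (\<lambda>(u, v) (u', v'). {u<..<v} \<inter> {u'<..<v'} = {}) D
        \<and> (\<Sum>(u, v)\<in>D. v - u) < \<delta>
      \<longrightarrow> (\<Sum>(u, v)\<in>D. norm (f v - f u)) < \<epsilon>)"

(* The derivative of a function whose domain is {t0..}: one-sided at t0, the ordinary
   derivative at every t > t0, and independent of the values of f below t0. *)
definition deriv_from :: "real \<Rightarrow> (real \<Rightarrow> 'a::real_normed_vector) \<Rightarrow> real \<Rightarrow> 'a" where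
  "deriv_from t0 f t = vector_derivative f (at t within {t0..})"

definition C1_from :: "real \<Rightarrow> (real \<Rightarrow> 'a::real_normed_vector) \<Rightarrow> bool" where
  "C1_from t0 f \<longleftrightarrow>
    (\<forall>t\<ge>t0. f differentiable (at t within {t0..})) \<and> continuous_on {t0..} (deriv_from t0 f)"

(* In the almost-everywhere clause a is the second derivative of y at t and b is the
   derivative of V o y at t; that both exist is part of the equation holding at t. *)
definition is_solution ::
  "('a::real_inner \<Rightarrow> 'a) \<Rightarrow> real \<Rightarrow> real \<Rightarrow> (real \<Rightarrow> real) \<Rightarrow> (real \<Rightarrow> real) \<Rightarrow> (real \<Rightarrow> 'a) \<Rightarrow> bool" where
  "is_solution V t0 lam \<mu> \<gamma> y \<longleftrightarrow>
    (\<forall>t\<ge>t0. y differentiable (at t within {t0..})) \<and>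
    (\<forall>t1\<ge>t0. absolutely_continuous_on {t0..t1} y
           \<and> absolutely_continuous_on {t0..t1} (deriv_from t0 y)
           \<and> absolutely_continuous_on {t0..t1} (\<lambda>t. V (y t))) \<and>
    (AE t in lebesgue. t \<ge> t0 \<longrightarrow>
      (\<exists>a b. (deriv_from t0 y has_vector_derivative a) (at t within {t0..})
           \<and> ((\<lambda>s. V (y s)) has_vector_derivative b) (at t within {t0..})
           \<and> a + lam *\<^sub>R deriv_from t0 y t + \<mu> t *\<^sub>R b + \<gamma> t *\<^sub>R V (y t) = 0))"

definition weakly_tendsto :: "('b \<Rightarrow> 'a::real_inner) \<Rightarrow> 'a \<Rightarrow> 'b filter \<Rightarrow> bool" where
  "weakly_tendsto f z F \<longleftrightarrow> (\<forall>h. ((\<lambda>t. f t \<bullet> h) \<longlongrightarrow> z \<bullet> h) F)"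

end

theory Submission
  imports Defs
begin

text \<open>Write \<open>z = y - x\<^sub>*\<close>, \<open>v = y'\<close>, \<open>W = V y\<close> and \<open>w = \<mu> W\<close>. For every constant \<open>\<eta>\<close> close to \<open>\<lambda> + L\<close>
  the energy \<open>E\<^sub>\<eta> = \<eta> P + R\<close> with \<open>P = \<lambda> |z|\<^sup>2 + 2 z \<bullet> (v + w)\<close> and \<open>R = (|2 v + w|\<^sup>2 + |w|\<^sup>2) / 2\<close> is
  nonnegative and eventually satisfies \<open>E\<^sub>\<eta>' \<le> - c R\<close> almost everywhere for some \<open>c > 0\<close>; the choice
  \<open>\<eta> = \<lambda> + L\<close> makes the coefficients of \<open>v \<bullet> w\<close> and \<open>|w|\<^sup>2\<close> in the dissipation asymptotically equal.
  As the energy is affine in \<open>\<eta>\<close>, convergence for two values of \<open>\<eta>\<close> gives convergence of \<open>P\<close> and of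
  \<open>R\<close>, and the dissipation forces \<open>R \<longrightarrow> 0\<close>. Hence \<open>v\<close> and \<open>w\<close> tend to \<open>0\<close> and \<open>|z|\<close> converges, for
  every zero \<open>x\<^sub>*\<close>, and weak convergence follows by Opial's argument.\<close>

subsection \<open>Absolutely continuous functions\<close>

definition small_packing :: "real set \<Rightarrow> real \<Rightarrow> (real \<times> real) set \<Rightarrow> bool" where
  "small_packing I \<delta> D \<longleftrightarrow> finite D \<and> (\<forall>(u, v)\<in>D. u \<le> v \<and> {u..v} \<subseteq> I)
    \<and> pairwise (\<lambda>(u, v) (u', v'). {u<..<v} \<inter> {u'<..<v'} = {}) D \<and> (\<Sum>(u, v)\<in>D. v - u) < \<delta>"

lemma absolutely_continuous_on_altdef:
  "absolutely_continuous_on I f \<longleftrightarrow>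
    (\<forall>\<epsilon>>0. \<exists>\<delta>>0. \<forall>D. small_packing I \<delta> D \<longrightarrow> (\<Sum>(u, v)\<in>D. norm (f v - f u)) < \<epsilon>)"
  unfolding absolutely_continuous_on_def small_packing_def ..

lemma small_packing_mono: "small_packing I \<delta> D \<Longrightarrow> \<delta> \<le> \<delta>' \<Longrightarrow> small_packing I \<delta>' D"
  by (auto simp: small_packing_def)

lemma small_packing_mem: "small_packing I \<delta> D \<Longrightarrow> (u, v) \<in> D \<Longrightarrow> u \<le> v \<and> u \<in> I \<and> v \<in> I"
  by (force simp: small_packing_def)

lemma absolutely_continuous_onD:
  assumes "absolutely_continuous_on I f" "\<epsilon> > 0"
  shows "\<exists>\<delta>>0. \<forall>D. small_packing I \<delta> D \<longrightarrow> (\<Sum>(u, v)\<in>D. norm (f v - f u)) < \<epsilon>"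
  using assms unfolding absolutely_continuous_on_altdef by simp

text \<open>Common source of the closure rules below: sums, multiples, bilinear images and C1
  functions all have increments bounded in this way. The codomains are independent, so scalar and
  vector factors can be mixed.\<close>

lemma absolutely_continuous_on_dominated:
  fixes f :: "real \<Rightarrow> 'a::real_normed_vector" and g :: "real \<Rightarrow> 'b::real_normed_vector"
    and h :: "real \<Rightarrow> 'c::real_normed_vector"
  assumes f: "absolutely_continuous_on I f" and g: "absolutely_continuous_on I g"
    and h: "\<And>u v. u \<in> I \<Longrightarrow> v \<in> I \<Longrightarrow>
      norm (h v - h u) \<le> A * norm (f v - f u) + B * norm (g v - g u)"
  shows "absolutely_continuous_on I h"
  unfolding absolutely_continuous_on_altdef
proof (intro allI impI)
  fix \<epsilon> :: real assume "\<epsilon> > 0"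
  \<comment> \<open>\<open>A\<close> and \<open>B\<close> may have either sign; \<open>C\<close>
    dominates both and is positive, so \<open>\<epsilon>\<close> can be divided by
    \<open>2 * C\<close>.\<close>
  define C where "C = 1 + \<bar>A\<bar> + \<bar>B\<bar>"
  have C: "C > 0" "A \<le> C" "B \<le> C" by (auto simp: C_def)
  have "\<epsilon> / (2 * C) > 0" using \<open>\<epsilon> > 0\<close> C by simp
  note \<epsilon> = this
  obtain \<delta>1 where \<delta>1: "\<delta>1 > 0" and 1: "\<And>D. small_packing I \<delta>1 D \<Longrightarrow> (\<Sum>(u, v)\<in>D. norm (f v - f u)) < \<epsilon> / (2 * C)"
    using absolutely_continuous_onD[OF f \<epsilon>] by blast
  obtain \<delta>2 where \<delta>2: "\<delta>2 > 0" and 2: "\<And>D. small_packing I \<delta>2 D \<Longrightarrow> (\<Sum>(u, v)\<in>D. norm (g v - g u)) < \<epsilon> / (2 * C)"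
    using absolutely_continuous_onD[OF g \<epsilon>] by blast
  show "\<exists>\<delta>>0. \<forall>D. small_packing I \<delta> D \<longrightarrow> (\<Sum>(u, v)\<in>D. norm (h v - h u)) < \<epsilon>"
  proof (intro exI[of _ "min \<delta>1 \<delta>2"] conjI allI impI)
    show "min \<delta>1 \<delta>2 > 0" using \<delta>1 \<delta>2 by simp
    fix D assume "small_packing I (min \<delta>1 \<delta>2) D"
    then have D: "small_packing I \<delta>1 D" "small_packing I \<delta>2 D"
      by (auto elim: small_packing_mono)
    have "(\<Sum>(u, v)\<in>D. norm (h v - h u))
        \<le> (\<Sum>(u, v)\<in>D. C * norm (f v - f u) + C * norm (g v - g u))"
    proof (rule sum_mono, clarify)
      fix u v assume "(u, v) \<in> D"
      then have "u \<in> I" "v \<in> I" using small_packing_mem[OF D(1)] by auto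
      from h[OF this] show "norm (h v - h u) \<le> C * norm (f v - f u) + C * norm (g v - g u)"
        using mult_right_mono[OF C(2), of "norm (f v - f u)"]
          mult_right_mono[OF C(3), of "norm (g v - g u)"] by simp
    qed
    also have "\<dots> = C * (\<Sum>(u, v)\<in>D. norm (f v - f u)) + C * (\<Sum>(u, v)\<in>D. norm (g v - g u))"
      by (simp add: case_prod_unfold sum.distrib sum_distrib_left)
    also have "\<dots> < C * (\<epsilon> / (2 * C)) + C * (\<epsilon> / (2 * C))"
      using 1[OF D(1)] 2[OF D(2)] C(1) by (intro add_strict_mono mult_strict_left_mono)
    also have "\<dots> = \<epsilon>" using C by simp
    finally show "(\<Sum>(u, v)\<in>D. norm (h v - h u)) < \<epsilon>" .
  qed
qed

lemma absolutely_continuous_on_subset: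
  assumes "absolutely_continuous_on I f" "J \<subseteq> I"
  shows "absolutely_continuous_on J f"
proof -
  have "small_packing I \<delta> D" if "small_packing J \<delta> D" for \<delta> D
    using that assms(2) by (fastforce simp: small_packing_def)
  then show ?thesis
    using assms(1) unfolding absolutely_continuous_on_altdef by meson
qed

lemma absolutely_continuous_on_ident: "absolutely_continuous_on I (\<lambda>t. t)"
  unfolding absolutely_continuous_on_altdef
proof (intro allI impI)
  fix \<epsilon> :: real assume "\<epsilon> > 0"
  show "\<exists>\<delta>>0. \<forall>D. small_packing I \<delta> D \<longrightarrow> (\<Sum>(u, v)\<in>D. norm (v - u)) < \<epsilon>"
  proof (intro exI[of _ \<epsilon>] conjI allI impI)
    show "\<epsilon> > 0" using \<open>\<epsilon> > 0\<close> .
    fix D assume D: "small_packing I \<epsilon> D"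
    have "(\<Sum>(u, v)\<in>D. norm (v - u)) = (\<Sum>(u, v)\<in>D. v - u)"
      by (rule sum.cong[OF refl]) (use small_packing_mem[OF D] in auto)
    then show "(\<Sum>(u, v)\<in>D. norm (v - u)) < \<epsilon>" using D by (simp add: small_packing_def)
  qed
qed

lemma absolutely_continuous_on_add:
  assumes "absolutely_continuous_on I f" "absolutely_continuous_on I g"
  shows "absolutely_continuous_on I (\<lambda>t. f t + g t)"
  by (rule absolutely_continuous_on_dominated[OF assms, where A = 1 and B = 1])
    (simp add: norm_diff_triangle_ineq)

lemma absolutely_continuous_on_cmul:
  assumes "absolutely_continuous_on I f"
  shows "absolutely_continuous_on I (\<lambda>t. c *\<^sub>R f t)"
  by (rule absolutely_continuous_on_dominated[OF assms assms, where A = "\<bar>c\<bar>" and B = 0])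
    (simp flip: scaleR_diff_right)

lemma absolutely_continuous_on_diff_const:
  assumes "absolutely_continuous_on I f"
  shows "absolutely_continuous_on I (\<lambda>t. f t - c)"
  by (rule absolutely_continuous_on_dominated[OF assms assms, where A = 1 and B = 0]) simp

lemma absolutely_continuous_on_imp_continuous_on:
  fixes f :: "real \<Rightarrow> 'a::real_normed_vector"
  assumes f: "absolutely_continuous_on {a..b} f"
  shows "continuous_on {a..b} f"
  unfolding continuous_on_iff
proof (intro ballI allI impI)
  fix x \<epsilon> :: real assume x: "x \<in> {a..b}" and "\<epsilon> > 0"
  obtain \<delta> where \<delta>: "\<delta> > 0" and *: "\<And>D. small_packing {a..b} \<delta> D \<Longrightarrow> (\<Sum>(u, v)\<in>D. norm (f v - f u)) < \<epsilon>"
    using absolutely_continuous_onD[OF f \<open>\<epsilon> > 0\<close>] by blast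
  \<comment> \<open>Tested on the packing that consists of the single interval between
    \<open>x\<close> and \<open>y\<close>.\<close>
  have "dist (f y) (f x) < \<epsilon>" if "y \<in> {a..b}" "dist y x < \<delta>" for y
    using *[of "{(min x y, max x y)}"] x that
    by (cases "x \<le> y") (auto simp: small_packing_def dist_norm norm_minus_commute pairwise_def min_def max_def)
  then show "\<exists>d>0. \<forall>y\<in>{a..b}. dist y x < d \<longrightarrow> dist (f y) (f x) < \<epsilon>" using \<delta> by blast
qed

text \<open>Both factors are continuous, hence bounded on the compact interval, and the increment of
  the product splits into one term per factor.\<close>

lemma absolutely_continuous_on_bilinear:
  assumes "bounded_bilinear h"
    and f: "absolutely_continuous_on {a..b} f"
    and g: "absolutely_continuous_on {a..b} g"
  shows "absolutely_continuous_on {a..b} (\<lambda>t. h (f t) (g t))"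
proof -
  interpret bounded_bilinear h by fact
  have "bounded (f ` {a..b})" "bounded (g ` {a..b})"
    using f g by (auto intro!: compact_imp_bounded compact_continuous_image
        absolutely_continuous_on_imp_continuous_on)
  then obtain F G where F: "\<And>t. t \<in> {a..b} \<Longrightarrow> norm (f t) \<le> F"
    and G: "\<And>t. t \<in> {a..b} \<Longrightarrow> norm (g t) \<le> G"
    unfolding bounded_iff by blast
  obtain K where K: "K > 0" "\<And>x y. norm (h x y) \<le> norm x * norm y * K" using pos_bounded by blast
  show ?thesis
  proof (rule absolutely_continuous_on_dominated[OF f g, where A = "G * K" and B = "F * K"])
    fix u v assume uv: "u \<in> {a..b}" "v \<in> {a..b}"
    have "h (f v) (g v) - h (f u) (g u) = h (f v - f u) (g u) + h (f v) (g v - g u)"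
      by (simp add: diff_left diff_right)
    then have "norm (h (f v) (g v) - h (f u) (g u))
        \<le> norm (f v - f u) * norm (g u) * K + norm (f v) * norm (g v - g u) * K"
      using norm_triangle_ineq[of "h (f v - f u) (g u)" "h (f v) (g v - g u)"]
        K(2)[of "f v - f u" "g u"] K(2)[of "f v" "g v - g u"] by simp
    also have "\<dots> \<le> norm (f v - f u) * G * K + F * norm (g v - g u) * K"
      using F[OF uv(2)] G[OF uv(1)] K(1)
      by (intro add_mono mult_right_mono mult_left_mono) auto
    finally show "norm (h (f v) (g v) - h (f u) (g u))
        \<le> G * K * norm (f v - f u) + F * K * norm (g v - g u)"
      by (simp add: algebra_simps)
  qed
qed

text \<open>The derivative is bounded on a compact interval, so \<open>f\<close> is Lipschitz there
  and its increments are dominated by those of the identity.\<close>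

lemma C1_from_imp_absolutely_continuous_on:
  fixes f :: "real \<Rightarrow> real"
  assumes f: "C1_from t0 f" and a: "t0 \<le> a"
  shows "absolutely_continuous_on {a..b} f"
proof -
  have sub: "{a..b} \<subseteq> {t0..}" using a by auto
  have der: "(f has_real_derivative deriv_from t0 f t) (at t within {a..b})" if "t \<in> {a..b}" for t
  proof -
    have "(f has_vector_derivative deriv_from t0 f t) (at t within {t0..})"
      using f that a unfolding C1_from_def deriv_from_def
      by (auto simp flip: vector_derivative_works)
    from has_vector_derivative_within_subset[OF this sub] show ?thesis
      by (simp add: has_real_derivative_iff_has_vector_derivative)
  qed
  have "bounded (deriv_from t0 f ` {a..b})"
    using f sub by (auto simp: C1_from_def intro!: compact_imp_bounded compact_continuous_image
        elim: continuous_on_subset)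
  then obtain B where B: "\<And>t. t \<in> {a..b} \<Longrightarrow> norm (deriv_from t0 f t) \<le> B"
    unfolding bounded_iff by blast
  show ?thesis
    by (rule absolutely_continuous_on_dominated[OF absolutely_continuous_on_ident
          absolutely_continuous_on_ident, where A = B and B = 0])
      (use field_differentiable_bound[OF _ der B] in auto)
qed

section \<open>Monotonicity from the sign of the derivative almost everywhere\<close>

text \<open>A fine tagged division splits into intervals tagged outside the null set, on which the
  derivative controls the increment, and intervals tagged in the null set, which lie in an open
  set of small measure, where absolute continuity controls the increment.\<close>

lemma absolutely_continuous_on_deriv_nonpos:
  fixes f :: "real \<Rightarrow> real"
  assumes ab: "a \<le> b" and f: "absolutely_continuous_on {a..b} f"
    and N: "N \<in> null_sets lebesgue"
    and der: "\<And>t. t \<in> {a..b} - N \<Longrightarrow> \<exists>d\<le>0. (f has_real_derivative d) (at t within {a..b})"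
  shows "f b \<le> f a"
proof -
  have "f b - f a \<le> 0 + e" if "e > 0" for e
  proof -
    \<comment> \<open>Half of \<open>e\<close> is spent on the intervals tagged outside
      \<open>N\<close>, half on those tagged in \<open>N\<close>. The summand 1 keeps the
      denominator positive when \<open>a = b\<close>.\<close>
    define e1 where "e1 = e / (2 * (b - a + 1))"
    have e1: "e1 > 0" "e1 * (b - a) \<le> e / 2"
      using \<open>e > 0\<close> ab by (auto simp: e1_def field_simps)
    have "e / 2 > 0" using \<open>e > 0\<close> by simp
    obtain \<delta> where \<delta>: "\<delta> > 0" and AC: "\<And>D. small_packing {a..b} \<delta> D \<Longrightarrow> (\<Sum>(u, v)\<in>D. norm (f v - f u)) < e / 2"
      using absolutely_continuous_onD[OF f \<open>e / 2 > 0\<close>] by blast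
    obtain U where U: "open U" "N \<subseteq> U" "U - N \<in> lmeasurable" "emeasure lebesgue (U - N) < ennreal \<delta>"
      using sets_lebesgue_outer_open[OF null_setsD2[OF N] \<delta>] by blast
    have Um: "U \<in> sets lebesgue" using U(1) by auto
    have "emeasure lebesgue U = emeasure lebesgue (U - N)"
      using N Um by (simp add: emeasure_Diff_null_set)
    then have U\<delta>: "emeasure lebesgue U < ennreal \<delta>" using U(4) by simp
    then have Ufm: "U \<in> lmeasurable" using Um by (auto simp: fmeasurable_def intro: less_trans)
    have Um\<delta>: "measure lebesgue U < \<delta>"
      using U\<delta> \<delta> emeasure_eq_measure2[OF Ufm] by (simp add: ennreal_less_iff)
    \<comment> \<open>Both end points are compared with the tag \<open>t\<close> between them: the
      error is at most \<open>e1\<close> times the length, and the linear part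
      \<open>(v - u) * d\<close> is nonpositive.\<close>
    have "\<exists>r>0. \<forall>u v. u \<in> {a..b} \<longrightarrow> v \<in> {a..b} \<longrightarrow> u \<le> t \<longrightarrow> t \<le> v \<longrightarrow> {u..v} \<subseteq> ball t r \<longrightarrow>
          f v - f u \<le> e1 * (v - u)" if t: "t \<in> {a..b} - N" for t
    proof -
      obtain d where d: "d \<le> 0" "(f has_real_derivative d) (at t within {a..b})" using der[OF t] by blast
      note has_derivative_within_alt[THEN iffD1, OF d(2)[unfolded has_field_derivative_def], THEN conjunct2, rule_format, OF e1(1)]
      then obtain r where r: "r > 0" "\<And>s. s \<in> {a..b} \<Longrightarrow> norm (s - t) < r \<Longrightarrow>
          norm (f s - f t - (s - t) * d) \<le> e1 * norm (s - t)"
        by (auto simp: mult.commute)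
      have "f v - f u \<le> e1 * (v - u)"
        if uv: "u \<in> {a..b}" "v \<in> {a..b}" "u \<le> t" "t \<le> v" "{u..v} \<subseteq> ball t r" for u v
      proof -
        have "{u, v} \<subseteq> ball t r" using uv(3-5) by (intro order_trans[OF _ uv(5)]) auto
        then have "f v - f t - (v - t) * d \<le> e1 * (v - t)" "- (f u - f t - (u - t) * d) \<le> e1 * (t - u)"
          using r(2)[of v] r(2)[of u] uv(1-4) by (auto simp: dist_real_def)
        moreover have "(v - u) * d \<le> 0" using d(1) uv by (simp add: mult_nonneg_nonpos)
        ultimately show ?thesis by (simp add: algebra_simps)
      qed
      then show ?thesis using r(1) by blast
    qed
    then obtain r where r: "\<And>t. t \<in> {a..b} - N \<Longrightarrow> r t > 0"
      "\<And>t u v. t \<in> {a..b} - N \<Longrightarrow> u \<in> {a..b} \<Longrightarrow> v \<in> {a..b} \<Longrightarrow> u \<le> t \<Longrightarrow> t \<le> v \<Longrightarrow> {u..v} \<subseteq> ball t (r t)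
         \<Longrightarrow> f v - f u \<le> e1 * (v - u)"
      by metis
    \<comment> \<open>A tag in \<open>N\<close> confines its interval to \<open>U\<close>; any other
      tag in \<open>{a..b}\<close> gets the radius at which the increment estimate holds. The last
      case only makes \<open>g\<close> a gauge on the whole line.\<close>
    define g where "g t = (if t \<in> N then U else if t \<in> {a..b} then ball t (r t) else ball t 1)" for t
    have "gauge g" unfolding gauge_def g_def using U(1,2) r(1) by auto
    then obtain p where p: "p tagged_division_of {a..b}" "g fine p"
      using fine_division_exists_real by blast
    note pD = tagged_division_ofD[OF p(1)]
    have K: "\<exists>u v. K = {u..v} \<and> u \<le> x \<and> x \<le> v \<and> {u..v} \<subseteq> {a..b} \<and> u \<in> {a..b} \<and> v \<in> {a..b}"
      if "(x, K) \<in> p" for x K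
      using pD(2-4)[OF that] by auto
    \<comment> \<open>Intervals with empty interior have increment zero. Without them, disjointness
      of interiors forces distinct members of \<open>q\<close> to have distinct pairs of end
      points.\<close>
    define q where "q = {(x, K) \<in> p. x \<in> N \<and> interior K \<noteq> {}}"
    have qp: "q \<subseteq> p" by (auto simp: q_def)
    have finq: "finite q" using pD(1) qp finite_subset by blast
    let ?io = "\<lambda>(x::real, K). (Inf K, Sup K :: real)"
    have qK: "K = {Inf K..Sup K}" "Inf K < Sup K" "{Inf K..Sup K} \<subseteq> {a..b}" "{Inf K..Sup K} \<subseteq> U"
      if "(x, K) \<in> q" for x K
    proof -
      have xK: "(x, K) \<in> p" "x \<in> N" "interior K \<noteq> {}" using that by (auto simp: q_def)
      from K[OF xK(1)] obtain u v where uv: "K = {u..v}" "u \<le> x" "x \<le> v" "{u..v} \<subseteq> {a..b}" by blast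
      have "K \<subseteq> g x" using p(2) xK(1) unfolding fine_def by blast
      then have "K \<subseteq> U" using xK(2) by (simp add: g_def)
      moreover have "u < v" using xK(3) uv(1) by simp
      ultimately show "K = {Inf K..Sup K}" "Inf K < Sup K" "{Inf K..Sup K} \<subseteq> {a..b}" "{Inf K..Sup K} \<subseteq> U"
        using uv by simp_all
    qed
    have disj: "interior K1 \<inter> interior K2 = {}"
      if "(x1, K1) \<in> q" "(x2, K2) \<in> q" "(x1, K1) \<noteq> (x2, K2)" for x1 K1 x2 K2
      using pD(5)[of x1 K1 x2 K2] that qp by (meson subsetD)
    have injio: "inj_on ?io q"
    proof (rule inj_onI, clarify)
      fix x1 K1 x2 K2 assume 1: "(x1, K1) \<in> q" and 2: "(x2, K2) \<in> q"
        and eq: "Inf K1 = Inf K2" "Sup K1 = Sup K2"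
      have "K1 = K2" using qK(1)[OF 1] qK(1)[OF 2] eq by metis
      moreover have "interior K1 \<noteq> {}" using 1 by (simp add: q_def)
      ultimately show "x1 = x2 \<and> K1 = K2" using disj[OF 1 2] by auto
    qed
    let ?D = "?io ` q"
    have Dpair: "pairwise (\<lambda>(u, v) (u', v'). {u<..<v} \<inter> {u'<..<v'} = {}) ?D"
    proof (rule pairwiseI)
      fix i j assume "i \<in> ?D" "j \<in> ?D" "i \<noteq> j"
      then obtain x1 K1 x2 K2 where 1: "(x1, K1) \<in> q" and 2: "(x2, K2) \<in> q"
        and ij: "i = (Inf K1, Sup K1)" "j = (Inf K2, Sup K2)" and "K1 \<noteq> K2"
        by auto
      then have "interior K1 \<inter> interior K2 = {}" by (intro disj) auto
      moreover have "interior K1 = {Inf K1<..<Sup K1}" "interior K2 = {Inf K2<..<Sup K2}"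
        using qK(1)[OF 1] qK(1)[OF 2] interior_atLeastAtMost_real by metis+
      ultimately show "(\<lambda>(u, v) (u', v'). {u<..<v} \<inter> {u'<..<v'} = {}) i j" using ij by simp
    qed
    have D: "u < v" "{u..v} \<subseteq> {a..b}" "{u..v} \<subseteq> U" if uv: "(u, v) \<in> ?D" for u v
    proof -
      obtain x K where "(x, K) \<in> q" "u = Inf K" "v = Sup K" using uv by auto
      then show "u < v" "{u..v} \<subseteq> {a..b}" "{u..v} \<subseteq> U" using qK(2-4) by blast+
    qed
    \<comment> \<open>The total length is the measure of a disjoint union of open intervals inside
      \<open>U\<close>, hence below \<open>\<delta>\<close>.\<close>
    have "(\<Sum>(u, v)\<in>?D. v - u) = (\<Sum>i\<in>?D. measure lebesgue {fst i<..<snd i})"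
      using D(1) by (intro sum.cong) (auto simp: less_imp_le)
    also have "\<dots> = measure lebesgue (\<Union>i\<in>?D. {fst i<..<snd i})"
      using Dpair finq by (intro measure_UNION'[symmetric])
        (auto simp: disjnt_def case_prod_unfold intro!: bounded_set_imp_lmeasurable)
    also have "\<dots> \<le> measure lebesgue U"
    proof (rule measure_mono_fmeasurable[OF _ _ Ufm])
      show "(\<Union>i\<in>?D. {fst i<..<snd i}) \<subseteq> U"
      proof (rule UN_least)
        fix i assume "i \<in> ?D"
        then have "{fst i..snd i} \<subseteq> U" by (intro D(3)) simp
        then show "{fst i<..<snd i} \<subseteq> U" by (rule order_trans[rotated]) auto
      qed
    qed (use finq in auto)
    finally have Dsum: "(\<Sum>(u, v)\<in>?D. v - u) < \<delta>" using Um\<delta> by simp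
    have "(\<Sum>(u, v)\<in>?D. norm (f v - f u)) < e / 2"
    proof (rule AC)
      have "\<forall>(u, v)\<in>?D. u \<le> v \<and> {u..v} \<subseteq> {a..b}" using D(1,2) less_imp_le by blast
      then show "small_packing {a..b} \<delta> ?D"
        unfolding small_packing_def using finq Dpair Dsum by blast
    qed
    also have "(\<Sum>(u, v)\<in>?D. norm (f v - f u)) = (\<Sum>(x, K)\<in>q. norm (f (Sup K) - f (Inf K)))"
      by (subst sum.reindex[OF injio]) (auto simp: case_prod_unfold)
    finally have q: "(\<Sum>(x, K)\<in>q. norm (f (Sup K) - f (Inf K))) < e / 2" .
    \<comment> \<open>Each remaining interval is either degenerate or tagged outside
      \<open>N\<close>.\<close>
    have "(\<Sum>(x, K)\<in>p - q. f (Sup K) - f (Inf K)) \<le> (\<Sum>(x, K)\<in>p - q. e1 * (Sup K - Inf K))"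
    proof (rule sum_mono, clarify)
      fix x K assume xK: "(x, K) \<in> p" "(x, K) \<notin> q"
      from K[OF xK(1)] obtain u v where uv: "K = {u..v}" "u \<le> x" "x \<le> v" "{u..v} \<subseteq> {a..b}"
        "u \<in> {a..b}" "v \<in> {a..b}" by blast
      show "f (Sup K) - f (Inf K) \<le> e1 * (Sup K - Inf K)"
      proof (cases "x \<in> N")
        case True
        then have "interior K = {}" using xK by (auto simp: q_def)
        then have "u = v" using uv by auto
        then show ?thesis using uv by simp
      next
        case False
        moreover have "{u..v} \<subseteq> g x" using p(2) xK(1) uv(1) by (auto simp: fine_def)
        moreover have "x \<in> {a..b}" using uv by auto
        ultimately show ?thesis using r(2)[of x u v] uv by (auto simp: g_def)
      qed
    qed
    also have "\<dots> \<le> (\<Sum>(x, K)\<in>p. e1 * (Sup K - Inf K))"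
      using e1(1) K by (intro sum_mono2 pD(1)) fastforce+
    also have "\<dots> = e1 * (\<Sum>(x, K)\<in>p. Sup K - Inf K)"
      by (simp add: sum_distrib_left case_prod_unfold)
    also have "\<dots> = e1 * (b - a)"
      using additive_tagged_division_1[OF ab p(1), of "\<lambda>x. x"] by simp
    finally have pq: "(\<Sum>(x, K)\<in>p - q. f (Sup K) - f (Inf K)) \<le> e / 2" using e1(2) by simp
    have "f b - f a = (\<Sum>(x, K)\<in>p. f (Sup K) - f (Inf K))"
      using additive_tagged_division_1[OF ab p(1), of f] by simp
    also have "\<dots> = (\<Sum>(x, K)\<in>p - q. f (Sup K) - f (Inf K)) + (\<Sum>(x, K)\<in>q. f (Sup K) - f (Inf K))"
      by (rule sum.subset_diff[OF qp pD(1)])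
    also have "(\<Sum>(x, K)\<in>q. f (Sup K) - f (Inf K)) \<le> (\<Sum>(x, K)\<in>q. norm (f (Sup K) - f (Inf K)))"
      by (rule sum_mono) auto
    finally show ?thesis using q pq by simp
  qed
  then have "f b - f a \<le> 0" by (rule field_le_epsilon)
  then show ?thesis by simp
qed

lemma absolutely_continuous_on_mult_const:
  fixes f :: "real \<Rightarrow> real"
  assumes "absolutely_continuous_on I f"
  shows "absolutely_continuous_on I (\<lambda>t. c * f t)"
  using absolutely_continuous_on_cmul[OF assms, of c] by simp

section \<open>Limits of dissipated functions\<close>

lemma antimono_tendsto_Inf:
  fixes E :: "real \<Rightarrow> real"
  assumes dec: "\<And>s t. T \<le> s \<Longrightarrow> s \<le> t \<Longrightarrow> E t \<le> E s" and nonneg: "\<And>t. T \<le> t \<Longrightarrow> 0 \<le> E t"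
  shows "(E \<longlongrightarrow> (INF t\<in>{T..}. E t)) at_top"
proof (rule decreasing_tendsto)
  have bb: "bdd_below (E ` {T..})" using nonneg by (intro bdd_belowI[of _ 0]) auto
  show "\<forall>\<^sub>F t in at_top. (INF t\<in>{T..}. E t) \<le> E t"
    using eventually_ge_at_top[of T] by eventually_elim (rule cINF_lower[OF bb], simp)
  fix x assume "(INF t\<in>{T..}. E t) < x"
  then obtain s where s: "T \<le> s" "E s < x" using cINF_less_iff[OF _ bb] by auto
  show "\<forall>\<^sub>F t in at_top. E t < x"
    using eventually_ge_at_top[of s] by eventually_elim (use dec[OF s(1)] s(2) in force)
qed

text \<open>Adding the linear function \<open>c * t\<close> makes the derivative nonpositive almost
  everywhere. The case \<open>c = 0\<close> gives plain monotonicity, a positive \<open>c\<close> a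
  linear rate of decay.\<close>

lemma dissipation_antimono:
  fixes E :: "real \<Rightarrow> real"
  assumes AC: "\<And>b. absolutely_continuous_on {T..b} E" and N: "N \<in> null_sets lebesgue"
    and der: "\<And>t. T \<le> t \<Longrightarrow> t \<notin> N \<Longrightarrow> \<exists>d. d \<le> - c \<and> (E has_real_derivative d) (at t within {T..})"
    and st: "T \<le> s" "s \<le> t"
  shows "E t + c * t \<le> E s + c * s"
proof (rule absolutely_continuous_on_deriv_nonpos[OF st(2) _ N])
  show "absolutely_continuous_on {s..t} (\<lambda>t. E t + c * t)"
    using st by (intro absolutely_continuous_on_add absolutely_continuous_on_mult_const
        absolutely_continuous_on_ident absolutely_continuous_on_subset[OF AC]) auto
  fix r assume r: "r \<in> {s..t} - N"
  then obtain d where d: "d \<le> - c" "(E has_real_derivative d) (at r within {T..})"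
    using der[of r] st by auto
  have "(E has_real_derivative d) (at r within {s..t})"
    by (rule DERIV_subset[OF d(2)]) (use st in auto)
  then have "((\<lambda>t. E t + c * t) has_real_derivative d + c) (at r within {s..t})"
    by (auto intro!: derivative_eq_intros)
  then show "\<exists>d\<le>0. ((\<lambda>t. E t + c * t) has_real_derivative d) (at r within {s..t})"
    using d(1) by (intro exI[of _ "d + c"]) auto
qed

lemma dissipation_convergent:
  fixes E :: "real \<Rightarrow> real"
  assumes AC: "\<And>b. absolutely_continuous_on {T..b} E" and N: "N \<in> null_sets lebesgue"
    and der: "\<And>t. T \<le> t \<Longrightarrow> t \<notin> N \<Longrightarrow> \<exists>d\<le>0. (E has_real_derivative d) (at t within {T..})"
    and nonneg: "\<And>t. T \<le> t \<Longrightarrow> 0 \<le> E t"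
  shows "\<exists>l. (E \<longlongrightarrow> l) at_top"
  using antimono_tendsto_Inf[of T E] dissipation_antimono[OF AC N, of 0] der nonneg by force

text \<open>If \<open>r\<close> were positive, \<open>R\<close> would eventually exceed
  \<open>r / 2\<close>, so \<open>E\<close> would fall at least linearly and become negative in
  finite time.\<close>

lemma dissipation_limit_zero:
  fixes E R :: "real \<Rightarrow> real"
  assumes AC: "\<And>b. absolutely_continuous_on {T..b} E" and N: "N \<in> null_sets lebesgue" and c: "c > 0"
    and der: "\<And>t. T \<le> t \<Longrightarrow> t \<notin> N \<Longrightarrow>
      \<exists>d. d \<le> - c * R t \<and> (E has_real_derivative d) (at t within {T..})"
    and nonneg: "\<And>t. T \<le> t \<Longrightarrow> 0 \<le> E t"
    and R: "\<And>t. 0 \<le> R t" "(R \<longlongrightarrow> r) at_top"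
  shows "r = 0"
proof (rule ccontr)
  assume "r \<noteq> 0"
  moreover have "0 \<le> r" using R by (intro tendsto_lowerbound[OF R(2)]) auto
  ultimately have r: "0 < r" by simp
  then have "\<forall>\<^sub>F t in at_top. r / 2 < R t \<and> T \<le> t"
    by (intro eventually_conj order_tendstoD(1)[OF R(2)] eventually_ge_at_top) simp
  then obtain S where S: "\<And>t. S \<le> t \<Longrightarrow> r / 2 < R t \<and> T \<le> t"
    unfolding eventually_at_top_linorder by blast
  define k where "k = c * (r / 2)"
  have k: "k > 0" using c r by (simp add: k_def)
  have TS: "T \<le> S" using S[of S] by simp
  have dec: "E t + k * t \<le> E S + k * S" if "S \<le> t" for t
  proof (rule dissipation_antimono[OF _ N _ order_refl that])
    show "absolutely_continuous_on {S..b} E" for b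
      using TS by (intro absolutely_continuous_on_subset[OF AC]) auto
    fix u assume u: "S \<le> u" "u \<notin> N"
    then obtain d where d: "d \<le> - c * R u" "(E has_real_derivative d) (at u within {T..})"
      using der[of u] TS by auto
    have "k \<le> c * R u" unfolding k_def using S[OF u(1)] c by (intro mult_left_mono) auto
    then have "d \<le> - k" using d(1) by simp
    moreover have "(E has_real_derivative d) (at u within {S..})"
      using DERIV_subset[OF d(2)] TS by auto
    ultimately show "\<exists>d. d \<le> - k \<and> (E has_real_derivative d) (at u within {S..})" by blast
  qed
  \<comment> \<open>Chosen so that \<open>k * (t - S)\<close> equals \<open>E S + 1\<close>, which
    forces \<open>E t\<close> to be at most -1.\<close>
  define t where "t = S + (E S + 1) / k"
  have ES: "0 \<le> E S" using nonneg TS by blast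
  then have "S \<le> t" using k by (simp add: t_def)
  moreover have "k * t = k * S + E S + 1" using k by (simp add: t_def field_simps)
  ultimately have "E t < 0" using dec[of t] by simp
  then show False using nonneg[of t] TS \<open>S \<le> t\<close> by simp
qed

subsection \<open>Energy estimates\<close>

text \<open>The cross term is absorbed through \<open>- v \<bullet> w \<le> |v|\<^sup>2 / 3 + 3 |w|\<^sup>2 / 4\<close>, which is where
  \<open>b \<le> 2 k\<close> enters.\<close>

lemma quadratic_form_coercive:
  fixes v w :: "'a::real_inner"
  assumes b: "b0 \<le> b" "b \<le> 2 * k" and s0: "s0 \<le> k / 12" "s0 \<le> b0 / 16" "0 < s0"
    and s: "\<bar>s\<bar> \<le> s0" and \<tau>: "\<bar>\<tau>\<bar> \<le> 2 * s0"
  shows "2 * s0 * (v \<bullet> v + w \<bullet> w) \<le> (k + s) * (v \<bullet> v) + (b + \<tau>) * (v \<bullet> w) + b * (w \<bullet> w)"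
proof -
  have vv: "0 \<le> v \<bullet> v" "0 \<le> w \<bullet> w" by auto
  have b0: "0 < b" using b s0 by linarith
  have "0 \<le> (2 *\<^sub>R v + 3 *\<^sub>R w) \<bullet> (2 *\<^sub>R v + 3 *\<^sub>R w)" by (rule inner_ge_zero)
  then have "0 \<le> v \<bullet> w + (v \<bullet> v) / 3 + 3 / 4 * (w \<bullet> w)"
    by (simp add: inner_add_left inner_add_right inner_commute)
  then have 1: "0 \<le> b * (v \<bullet> w + (v \<bullet> v) / 3 + 3 / 4 * (w \<bullet> w))" using b0 by simp
  have "0 \<le> (v + w) \<bullet> (v + w)" "0 \<le> (v - w) \<bullet> (v - w)" by (rule inner_ge_zero)+
  then have "\<bar>v \<bullet> w\<bar> \<le> (v \<bullet> v + w \<bullet> w) / 2"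
    by (simp add: inner_add_left inner_add_right inner_diff_left inner_diff_right inner_commute abs_le_iff)
  then have "\<bar>\<tau>\<bar> * \<bar>v \<bullet> w\<bar> \<le> (2 * s0) * ((v \<bullet> v + w \<bullet> w) / 2)" using \<tau> by (intro mult_mono) auto
  then have 2: "- s0 * (v \<bullet> v + w \<bullet> w) \<le> \<tau> * (v \<bullet> w)" by (simp add: abs_mult[symmetric] abs_le_iff)
  \<comment> \<open>Here \<open>k + s - b / 3\<close> is at least \<open>k / 3 - s0\<close>, hence
    at least \<open>3 * s0\<close>, and \<open>b / 4\<close> is at least \<open>4 * s0\<close>. The
    perturbation \<open>\<tau>\<close> costs each square at most \<open>s0\<close>, which leaves
    \<open>2 * s0\<close>.\<close>
  have 3: "(3 * s0) * (v \<bullet> v) \<le> (k + s - b / 3) * (v \<bullet> v)"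
    using b s0 s by (intro mult_right_mono vv) linarith
  have 4: "(3 * s0) * (w \<bullet> w) \<le> (b / 4) * (w \<bullet> w)"
    using b s0 by (intro mult_right_mono vv) linarith
  from 1 2 3 4 show ?thesis by (simp add: algebra_simps)
qed

definition energy :: "real \<Rightarrow> real \<Rightarrow> 'a::real_inner \<Rightarrow> 'a \<Rightarrow> 'a \<Rightarrow> real" where
  "energy lam \<eta> z v w = \<eta> * (lam * (z \<bullet> z) + 2 * (z \<bullet> (v + w)))
    + ((2 *\<^sub>R v + w) \<bullet> (2 *\<^sub>R v + w) + w \<bullet> w) / 2"

text \<open>Completing the square shows nonnegativity for \<open>0 < \<eta> < 2 * lam\<close> when
  \<open>z \<bullet> w\<close> is nonnegative; the \<open>z \<bullet> z\<close> term also bounds the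
  trajectory by its energy.\<close>

lemma energy_sum_of_squares:
  "energy lam \<eta> z v w = ((\<eta> *\<^sub>R z + 2 *\<^sub>R v + w) \<bullet> (\<eta> *\<^sub>R z + 2 *\<^sub>R v + w) + w \<bullet> w) / 2
    + \<eta> * (2 * lam - \<eta>) / 2 * (z \<bullet> z) + \<eta> * (z \<bullet> w)"
  unfolding energy_def
  by (simp add: inner_add_left inner_add_right inner_commute field_simps)

text \<open>The equation eliminates \<open>a\<close>. The derivative of \<open>v + w\<close> is then
  free of \<open>b\<close>, its part \<open>- lam z \<bullet> v\<close> cancels against the
  derivative of \<open>lam (z \<bullet> z) / 2\<close>, and the two squares contribute opposite
  multiples of \<open>w \<bullet> b\<close>. What remains is a quadratic form in \<open>v\<close>
  and \<open>w\<close> and two terms whose sign monotonicity decides.\<close>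

lemma energy_derivative:
  fixes v W a b z :: "'a::real_inner"
  assumes ode: "a + lam *\<^sub>R v + m *\<^sub>R b + g *\<^sub>R W = 0"
    and z: "(Z has_vector_derivative v) (at t within S)" "Z t = z"
    and v: "(X has_vector_derivative a) (at t within S)" "X t = v"
    and W: "(Y has_vector_derivative b) (at t within S)" "Y t = W"
    and m: "(M has_real_derivative m') (at t within S)" "M t = m"
    and m0: "m > 0"
  shows "((\<lambda>t. energy lam \<eta> (Z t) (X t) (M t *\<^sub>R Y t)) has_real_derivative
    - 2 * ((2 * lam - \<eta>) * (v \<bullet> v) + (lam - \<eta> + (g - m') / m + g / m) * (v \<bullet> (m *\<^sub>R W))
        + (g - m') / m * ((m *\<^sub>R W) \<bullet> (m *\<^sub>R W)))
    - 2 * \<eta> * (g - m') * (z \<bullet> W) - 2 * m * (v \<bullet> b)) (at t within S)"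
proof -
  have a: "a = - (lam *\<^sub>R v + m *\<^sub>R b + g *\<^sub>R W)" using ode by (metis add.assoc add_eq_0_iff2)
  have w: "((\<lambda>t. M t *\<^sub>R Y t) has_vector_derivative m *\<^sub>R b + m' *\<^sub>R W) (at t within S)"
    using has_vector_derivative_scaleR[OF m(1) W(1)] m(2) W(2) by simp
  have u: "((\<lambda>t. 2 *\<^sub>R X t + M t *\<^sub>R Y t) has_vector_derivative 2 *\<^sub>R a + (m *\<^sub>R b + m' *\<^sub>R W))
      (at t within S)"
    by (intro has_vector_derivative_add w
        bounded_linear.has_vector_derivative[OF bounded_linear_scaleR_right v(1)])
  note ip = bounded_bilinear.has_vector_derivative[OF bounded_bilinear_inner,
      folded has_real_derivative_iff_has_vector_derivative]
  show ?thesis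
    unfolding energy_def
    apply (rule DERIV_cong)
     apply (rule DERIV_add DERIV_cmult DERIV_cdivide ip[OF z(1) z(1)] ip[OF u u] ip[OF w w]
        ip[OF z(1) has_vector_derivative_add[OF v(1) w]])+
    using m0 unfolding a z(2) v(2) W(2) m(2)
    apply (simp add: inner_add_left inner_add_right inner_diff_left inner_diff_right
        inner_commute field_simps)
    done
qed

text \<open>The operator enters only through the signs of \<open>z t \<bullet> W t\<close> and
  \<open>v t \<bullet> b\<close>, so the estimate can be applied with \<open>z\<close> centred at
  any zero.\<close>

lemma trajectory_limits:
  fixes z v W :: "real \<Rightarrow> 'a::real_inner" and \<mu> \<mu>' \<gamma> :: "real \<Rightarrow> real"
  assumes z: "\<And>t. t0 \<le> t \<Longrightarrow> (z has_vector_derivative v t) (at t within {t0..})"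
    and AC: "\<And>t. t0 \<le> t \<Longrightarrow> absolutely_continuous_on {t0..t} z"
      "\<And>t. t0 \<le> t \<Longrightarrow> absolutely_continuous_on {t0..t} v"
      "\<And>t. t0 \<le> t \<Longrightarrow> absolutely_continuous_on {t0..t} W"
      "\<And>t. t0 \<le> t \<Longrightarrow> absolutely_continuous_on {t0..t} \<mu>"
    and \<mu>': "\<And>t. t0 \<le> t \<Longrightarrow> (\<mu> has_real_derivative \<mu>' t) (at t within {t0..})"
    and pos: "\<And>t. t0 \<le> t \<Longrightarrow> 0 < \<mu> t" "\<And>t. t0 \<le> t \<Longrightarrow> 0 < \<gamma> t"
    and zW: "\<And>t. t0 \<le> t \<Longrightarrow> 0 \<le> z t \<bullet> W t"
    and N: "N \<in> null_sets lebesgue"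
    and ode: "\<And>t. t0 \<le> t \<Longrightarrow> t \<notin> N \<Longrightarrow> \<exists>a b. (v has_vector_derivative a) (at t within {t0..})
      \<and> (W has_vector_derivative b) (at t within {t0..}) \<and> 0 \<le> v t \<bullet> b
      \<and> a + lam *\<^sub>R v t + \<mu> t *\<^sub>R b + \<gamma> t *\<^sub>R W t = 0"
    and L: "((\<lambda>t. \<gamma> t / \<mu> t) \<longlongrightarrow> L) at_top" "0 < L" and lam: "0 < lam"
    and r1: "r1 < 1" "\<And>t. t0 \<le> t \<Longrightarrow> \<mu>' t / \<gamma> t \<le> r1"
    and r2: "3 * L - 2 * lam < r2" "\<And>t. t0 \<le> t \<Longrightarrow> r2 \<le> \<mu>' t / \<mu> t"
  shows "((\<lambda>t. norm (v t)) \<longlongrightarrow> 0) at_top" "((\<lambda>t. norm (\<mu> t *\<^sub>R W t)) \<longlongrightarrow> 0) at_top"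
    "((\<lambda>t. z t \<bullet> (\<mu> t *\<^sub>R W t)) \<longlongrightarrow> 0) at_top" "\<exists>l. ((\<lambda>t. norm (z t)) \<longlongrightarrow> l) at_top"
proof -
  define w where "w t = \<mu> t *\<^sub>R W t" for t
  \<comment> \<open>For \<open>\<eta> = lam + L - s\<close> the dissipation has the coefficient
    \<open>k + s\<close> at \<open>v \<bullet> v\<close> and \<open>b t\<close> at
    \<open>w \<bullet> w\<close>; \<open>b0\<close> bounds \<open>b t\<close> from below as soon as
    \<open>\<gamma> t / \<mu> t\<close> is at least \<open>L / 2\<close>.\<close>
  define b where "b t = (\<gamma> t - \<mu>' t) / \<mu> t" for t
  define k where "k = lam - L"
  define b0 where "b0 = (1 - r1) * (L / 2)"
  define R where "R t = ((2 *\<^sub>R v t + w t) \<bullet> (2 *\<^sub>R v t + w t) + w t \<bullet> w t) / 2" for t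
  define E where "E s t = energy lam (lam + L - s) (z t) (v t) (w t)" for s t
  define P where "P t = lam * (z t \<bullet> z t) + 2 * (z t \<bullet> (v t + w t))" for t
  have b0: "0 < b0" using r1(1) L(2) by (simp add: b0_def)
  have b_ge: "b0 \<le> b t" if t: "t0 \<le> t" "L / 2 \<le> \<gamma> t / \<mu> t" for t
  proof -
    have "b0 \<le> (1 - \<mu>' t / \<gamma> t) * (\<gamma> t / \<mu> t)"
      unfolding b0_def using t r1(1) r1(2)[OF t(1)] L(2) by (intro mult_mono) auto
    also have "\<dots> = b t" using pos[OF t(1)] by (simp add: b_def field_simps)
    finally show ?thesis .
  qed
  \<comment> \<open>The margin \<open>r2 - (3 * L - 2 * lam)\<close> is positive and is exactly the
    amount by which \<open>\<gamma> t / \<mu> t\<close> may exceed \<open>L\<close>: subtracting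
    \<open>\<mu>' t / \<mu> t\<close>, which is at least \<open>r2\<close>, leaves at most
    \<open>2 * (lam - L)\<close>.\<close>
  have b_le: "b t \<le> 2 * k" if t: "t0 \<le> t" "\<gamma> t / \<mu> t < L + (r2 - (3 * L - 2 * lam))" for t
    using r2(2)[OF t(1)] t(2) by (simp add: b_def k_def diff_divide_distrib)
  have ev: "\<forall>\<^sub>F t in at_top. t0 \<le> t \<and> L / 2 < \<gamma> t / \<mu> t \<and> \<gamma> t / \<mu> t < L + (r2 - (3 * L - 2 * lam))"
    using L(2) r2(1)
    by (intro eventually_conj eventually_ge_at_top order_tendstoD[OF L(1)]) auto
  obtain t where "t0 \<le> t" "L / 2 \<le> \<gamma> t / \<mu> t" "\<gamma> t / \<mu> t < L + (r2 - (3 * L - 2 * lam))"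
    using eventually_happens'[OF _ ev] by (auto intro: less_imp_le)
  \<comment> \<open>That \<open>lam\<close> exceeds \<open>L\<close> is not assumed; it follows by
    squeezing \<open>b t\<close> between \<open>b0\<close> and \<open>2 * k\<close> at one
    time.\<close>
  then have k: "0 < k" using b_ge[of t] b_le[of t] b0 by linarith
  \<comment> \<open>One number serves as the size of the shift in \<open>\<eta>\<close>, as the
    tolerance for \<open>\<gamma> t / \<mu> t - L\<close> and as the dissipation rate.\<close>
  define s0 where "s0 = min (k / 12) (b0 / 16)"
  have s0: "s0 \<le> k / 12" "s0 \<le> b0 / 16" "0 < s0" using k b0 by (auto simp: s0_def)
  have "\<forall>\<^sub>F t in at_top. (t0 \<le> t \<and> L / 2 < \<gamma> t / \<mu> t \<and> \<gamma> t / \<mu> t < L + (r2 - (3 * L - 2 * lam)))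
      \<and> (L - s0 < \<gamma> t / \<mu> t \<and> \<gamma> t / \<mu> t < L + s0)"
    using s0(3) by (intro eventually_conj ev order_tendstoD[OF L(1)]) auto
  then obtain T where T': "\<And>t. T \<le> t \<Longrightarrow> (t0 \<le> t \<and> L / 2 < \<gamma> t / \<mu> t
      \<and> \<gamma> t / \<mu> t < L + (r2 - (3 * L - 2 * lam))) \<and> (L - s0 < \<gamma> t / \<mu> t \<and> \<gamma> t / \<mu> t < L + s0)"
    unfolding eventually_at_top_linorder by blast
  then have T: "t0 \<le> t" "\<bar>\<gamma> t / \<mu> t - L\<bar> \<le> s0" "b0 \<le> b t" "b t \<le> 2 * k" if "T \<le> t" for t
    using T'[OF that] b_ge[of t] b_le[of t] by (auto simp: abs_le_iff)
  have t0T: "t0 \<le> T" using T(1) by blast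
  have \<eta>: "0 < lam + L - s" "2 * lam - (lam + L - s) = k + s" "0 < k + s" if "\<bar>s\<bar> \<le> s0" for s
    using that s0 k L(2) lam by (auto simp: k_def abs_le_iff)
  have zw: "0 \<le> z t \<bullet> w t" if "T \<le> t" for t
    using zW[OF T(1)[OF that]] pos(1)[OF T(1)[OF that]] by (simp add: w_def)
  have E_ge: "(lam + L - s) * (k + s) / 2 * (z t \<bullet> z t) \<le> E s t" if "\<bar>s\<bar> \<le> s0" "T \<le> t" for s t
    unfolding E_def energy_sum_of_squares \<eta>(2)[OF that(1)]
    using zw[OF that(2)] \<eta>(1)[OF that(1)] by (simp add: add_nonneg_nonneg)
  have E_nonneg: "0 \<le> E s t" if "\<bar>s\<bar> \<le> s0" "T \<le> t" for s t
    by (rule order_trans[OF _ E_ge[OF that]])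
      (use \<eta>[OF that(1)] in \<open>auto intro!: mult_nonneg_nonneg\<close>)
  have R_nonneg: "0 \<le> R t" for t by (simp add: R_def)
  have E_AC: "absolutely_continuous_on {T..c} (E s)" for c s
  proof -
    \<comment> \<open>Absolute continuity is given only up to end points beyond \<open>t0\<close>,
      whereas \<open>c\<close> is arbitrary.\<close>
    have sub: "{T..c} \<subseteq> {t0..max t0 c}" "t0 \<le> max t0 c" using t0T by auto
    note ac = AC[OF sub(2), THEN absolutely_continuous_on_subset[OF _ sub(1)]]
    note ip = absolutely_continuous_on_bilinear[OF bounded_bilinear_inner]
    have w: "absolutely_continuous_on {T..c} w"
      unfolding w_def by (rule absolutely_continuous_on_bilinear[OF bounded_bilinear_scaleR ac(4,3)])
    have "absolutely_continuous_on {T..c} (\<lambda>t. (lam + L - s) * (lam * (z t \<bullet> z t) + 2 * (z t \<bullet> (v t + w t)))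
      + (1/2) * ((2 *\<^sub>R v t + w t) \<bullet> (2 *\<^sub>R v t + w t) + w t \<bullet> w t))"
      by (intro absolutely_continuous_on_add absolutely_continuous_on_mult_const ip
          absolutely_continuous_on_cmul ac w)
    then show ?thesis unfolding E_def energy_def by simp
  qed
  have E_der: "\<exists>d. d \<le> - s0 * R t \<and> (E s has_real_derivative d) (at t within {T..})"
    if s: "\<bar>s\<bar> \<le> s0" and t: "T \<le> t" "t \<notin> N" for s t
  proof -
    note tt = T[OF t(1)]
    obtain a c where ac: "(v has_vector_derivative a) (at t within {t0..})"
      "(W has_vector_derivative c) (at t within {t0..})" "0 \<le> v t \<bullet> c"
      "a + lam *\<^sub>R v t + \<mu> t *\<^sub>R c + \<gamma> t *\<^sub>R W t = 0"
      using ode[OF tt(1) t(2)] by blast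
    \<comment> \<open>The coefficient \<open>lam - \<eta> + b t + \<gamma> t / \<mu> t\<close> of
      \<open>v \<bullet> w\<close> is \<open>b t\<close> perturbed by
      \<open>s + (\<gamma> t / \<mu> t - L)\<close>, which is at most \<open>2 * s0\<close> in
      absolute value.\<close>
    define Q where "Q = (k + s) * (v t \<bullet> v t) + (b t + (s + (\<gamma> t / \<mu> t - L))) * (v t \<bullet> w t) + b t * (w t \<bullet> w t)"
    define d where "d = - 2 * Q - 2 * (lam + L - s) * (\<gamma> t - \<mu>' t) * (z t \<bullet> W t) - 2 * \<mu> t * (v t \<bullet> c)"
    have "(E s has_real_derivative d) (at t within {t0..})"
      using energy_derivative[OF ac(4) z[OF tt(1)] refl ac(1) refl ac(2) refl \<mu>'[OF tt(1)] refl pos(1)[OF tt(1)],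
          of "lam + L - s"]
      unfolding E_def[abs_def] w_def d_def Q_def b_def \<eta>(2)[OF s] by (simp add: algebra_simps)
    then have "(E s has_real_derivative d) (at t within {T..})"
      by (rule DERIV_subset) (use t0T in auto)
    moreover have "d \<le> - s0 * R t"
    proof -
      have "\<bar>s + (\<gamma> t / \<mu> t - L)\<bar> \<le> 2 * s0" using s tt(2) by linarith
      then have "2 * s0 * (v t \<bullet> v t + w t \<bullet> w t) \<le> Q"
        unfolding Q_def by (rule quadratic_form_coercive[OF tt(3,4) s0 s])
      moreover have "R t \<le> 4 * (v t \<bullet> v t + w t \<bullet> w t)"
      proof -
        have "0 \<le> (2 *\<^sub>R v t - w t) \<bullet> (2 *\<^sub>R v t - w t)" by (rule inner_ge_zero)
        then have "4 * (v t \<bullet> w t) \<le> 4 * (v t \<bullet> v t) + w t \<bullet> w t"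
          by (simp add: inner_diff_left inner_diff_right inner_commute)
        moreover have "R t = 2 * (v t \<bullet> v t) + 2 * (v t \<bullet> w t) + w t \<bullet> w t"
          by (simp add: R_def inner_add_left inner_add_right inner_commute)
        ultimately show ?thesis using inner_ge_zero[of "v t"] inner_ge_zero[of "w t"] by argo
      qed
      then have "s0 * R t \<le> s0 * (4 * (v t \<bullet> v t + w t \<bullet> w t))" using s0(3) by (intro mult_left_mono) auto
      moreover have "0 \<le> (lam + L - s) * (\<gamma> t - \<mu>' t) * (z t \<bullet> W t)"
      proof (intro mult_nonneg_nonneg)
        have "0 < b t" using tt(3) b0 by linarith
        then show "0 \<le> \<gamma> t - \<mu>' t" using pos(1)[OF tt(1)] by (simp add: b_def zero_less_divide_iff)
      qed (use \<eta>(1)[OF s] zW[OF tt(1)] in auto)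
      moreover have "0 \<le> \<mu> t * (v t \<bullet> c)" using ac(3) pos(1)[OF tt(1)] by simp
      ultimately show ?thesis unfolding d_def by (simp add: algebra_simps)
    qed
    ultimately show ?thesis by blast
  qed
  have E_lim: "\<exists>l. (E s \<longlongrightarrow> l) at_top" if "\<bar>s\<bar> \<le> s0" for s
  proof (rule dissipation_convergent[OF E_AC N _ E_nonneg[OF that]])
    fix t assume "T \<le> t" "t \<notin> N"
    moreover have "- s0 * R t \<le> 0" using s0(3) R_nonneg by simp
    ultimately show "\<exists>d\<le>0. (E s has_real_derivative d) (at t within {T..})"
      using E_der[OF that] by (meson order_trans)
  qed
  have "\<bar>s0\<bar> \<le> s0" "\<bar>- s0\<bar> \<le> s0" using s0(3) by auto
  then obtain l1 l2 where l: "(E s0 \<longlongrightarrow> l1) at_top" "(E (- s0) \<longlongrightarrow> l2) at_top" using E_lim by blast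
  have EPR: "E s t = (lam + L - s) * P t + R t" for s t
    by (simp add: E_def P_def R_def energy_def)
  \<comment> \<open>The energies for the shifts \<open>- s0\<close> and \<open>s0\<close> differ by
    \<open>2 * s0 * P t\<close>.\<close>
  have P_eq: "P t = (E (- s0) t - E s0 t) / (2 * s0)" for t
    using s0(3) by (simp add: EPR field_simps)
  have P: "(P \<longlongrightarrow> (l2 - l1) / (2 * s0)) at_top"
    unfolding P_eq[abs_def] using s0(3) by (intro tendsto_intros l) auto
  have R_eq: "R t = E s0 t - (lam + L - s0) * P t" for t by (simp add: EPR)
  have R: "(R \<longlongrightarrow> l1 - (lam + L - s0) * ((l2 - l1) / (2 * s0))) at_top"
    unfolding R_eq[abs_def] by (intro tendsto_intros l P)
  have "l1 - (lam + L - s0) * ((l2 - l1) / (2 * s0)) = 0"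
    by (rule dissipation_limit_zero[OF E_AC N s0(3) E_der[of s0] E_nonneg[of s0] R_nonneg R])
      (use s0(3) in auto)
  then have R0: "(R \<longlongrightarrow> 0) at_top" using R by simp
  have w_le: "(norm (w t))\<^sup>2 \<le> 2 * R t" for t by (simp add: R_def power2_norm_eq_inner)
  have v_le: "(norm (v t))\<^sup>2 \<le> 2 * R t" for t
  proof -
    have "0 \<le> (v t + w t) \<bullet> (v t + w t)" by (rule inner_ge_zero)
    moreover have "2 * R t - v t \<bullet> v t = v t \<bullet> v t + 2 * ((v t + w t) \<bullet> (v t + w t))"
      by (simp add: R_def inner_add_left inner_add_right inner_commute)
    ultimately show ?thesis using inner_ge_zero[of "v t"] unfolding power2_norm_eq_inner by argo
  qed
  have sq0: "((\<lambda>t. norm (f t)) \<longlongrightarrow> 0) at_top" if "\<And>t. (norm (f t))\<^sup>2 \<le> 2 * R t" for f :: "real \<Rightarrow> 'a"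
  proof -
    have "((\<lambda>t. 2 * R t) \<longlongrightarrow> 0) at_top" using tendsto_mult_left[OF R0, of 2] by simp
    then have "((\<lambda>t. (norm (f t))\<^sup>2) \<longlongrightarrow> 0) at_top"
      by (rule Lim_null_comparison[rotated]) (use that in simp)
    from tendsto_real_sqrt[OF this] show ?thesis by simp
  qed
  show v0: "((\<lambda>t. norm (v t)) \<longlongrightarrow> 0) at_top" by (rule sq0[OF v_le])
  have w0: "((\<lambda>t. norm (w t)) \<longlongrightarrow> 0) at_top" by (rule sq0[OF w_le])
  then show "((\<lambda>t. norm (\<mu> t *\<^sub>R W t)) \<longlongrightarrow> 0) at_top" unfolding w_def .
  \<comment> \<open>Bound for \<open>z t \<bullet> z t\<close> obtained from \<open>E_ge\<close>
    once the energy is below \<open>l1 + 1\<close>. Boundedness of \<open>z\<close> makes its inner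
    products with null functions vanish in the limit.\<close>
  define C where "C = (l1 + 1) / ((lam + L - s0) * (k + s0) / 2)"
  have "\<forall>\<^sub>F t in at_top. E s0 t < l1 + 1" by (rule order_tendstoD(2)[OF l(1)]) simp
  then have z_bd: "\<forall>\<^sub>F t in at_top. norm (z t) \<le> sqrt C"
    using eventually_ge_at_top[of T]
  proof eventually_elim
    case (elim t)
    have "0 < (lam + L - s0) * (k + s0) / 2" using \<eta>[of s0] s0(3) by simp
    then have "z t \<bullet> z t \<le> C"
      using E_ge[of s0 t] elim s0(3) unfolding C_def by (simp add: pos_le_divide_eq mult.commute)
    then show ?case by (simp add: norm_eq_sqrt_inner)
  qed
  have inner0: "((\<lambda>t. z t \<bullet> f t) \<longlongrightarrow> 0) at_top" if "((\<lambda>t. norm (f t)) \<longlongrightarrow> 0) at_top" for f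
  proof (rule Lim_null_comparison)
    show "\<forall>\<^sub>F t in at_top. norm (z t \<bullet> f t) \<le> sqrt C * norm (f t)"
      using z_bd
    proof eventually_elim
      case (elim t)
      then show ?case
        using Cauchy_Schwarz_ineq2[of "z t" "f t"] mult_right_mono[OF elim, of "norm (f t)"] by simp
    qed
    show "((\<lambda>t. sqrt C * norm (f t)) \<longlongrightarrow> 0) at_top" using tendsto_mult_left[OF that, of "sqrt C"] by simp
  qed
  from inner0[OF w0] show "((\<lambda>t. z t \<bullet> (\<mu> t *\<^sub>R W t)) \<longlongrightarrow> 0) at_top" unfolding w_def .
  \<comment> \<open>\<open>P\<close> and \<open>lam\<close> times the squared norm of
    \<open>z\<close> differ by a null function, so convergence of \<open>P\<close> transfers to the
    norm.\<close>
  have "norm (z t) = sqrt ((P t - 2 * (z t \<bullet> v t + z t \<bullet> w t)) / lam)" for t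
    using lam by (simp add: P_def norm_eq_sqrt_inner inner_add_right)
  moreover have "((\<lambda>t. sqrt ((P t - 2 * (z t \<bullet> v t + z t \<bullet> w t)) / lam)) \<longlongrightarrow>
      sqrt (((l2 - l1) / (2 * s0) - 2 * (0 + 0)) / lam)) at_top"
    using lam by (intro tendsto_intros P inner0 v0 w0) auto
  ultimately show "\<exists>l. ((\<lambda>t. norm (z t)) \<longlongrightarrow> l) at_top" by auto
qed

subsection \<open>Weak convergence\<close>

text \<open>The squared distances \<open>d n\<close> from the origin increase and are bounded.
  Near-minimisers then form a Cauchy sequence by the parallelogram law, and its limit lies in every
  set.\<close>

lemma nested_closed_convex_Int_nonempty:
  fixes C :: "nat \<Rightarrow> 'a::{real_inner, complete_space} set"
  assumes cl: "\<And>n. closed (C n)" and cv: "\<And>n. convex (C n)" and ne: "\<And>n. C n \<noteq> {}"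
    and dec: "\<And>m n. m \<le> n \<Longrightarrow> C n \<subseteq> C m" and bd: "bounded (C 0)"
  shows "\<exists>p. \<forall>n. p \<in> C n"
proof -
  define d where "d n = (INF x\<in>C n. (norm x)\<^sup>2)" for n
  have bb: "bdd_below ((\<lambda>x. (norm x)\<^sup>2) ` C n)" for n by (rule bdd_belowI[of _ 0]) auto
  have d_le: "d n \<le> (norm x)\<^sup>2" if "x \<in> C n" for x n
    unfolding d_def by (rule cINF_lower[OF bb that])
  have "\<exists>x\<in>C n. (norm x)\<^sup>2 < d n + 1 / real (Suc n)" for n
    using cINF_less_iff[OF ne[of n] bb[of n], of "d n + 1 / real (Suc n)"] by (simp add: d_def)
  then obtain x where xC: "\<And>n. x n \<in> C n" and xd: "\<And>n. (norm (x n))\<^sup>2 < d n + 1 / real (Suc n)"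
    by metis
  obtain B where B: "\<And>x. x \<in> C 0 \<Longrightarrow> norm x \<le> B" using bd unfolding bounded_iff by blast
  have "incseq d"
    unfolding incseq_def d_def using dec ne bb by (auto intro!: cINF_superset_mono)
  moreover have "d n \<le> B\<^sup>2" for n
  proof -
    have "norm (x n) \<le> B" using B xC dec[of 0 n] by auto
    then show ?thesis using d_le[OF xC[of n]] power_mono[of "norm (x n)" B 2] by simp
  qed
  ultimately obtain D where D: "d \<longlonglongrightarrow> D" "\<And>n. d n \<le> D" using incseq_convergent by metis
  have dist: "(dist (x n) (x m))\<^sup>2 \<le> 2 * (D - d n) + 4 / real (Suc n)" if "n \<le> m" for n m
  proof -
    \<comment> \<open>As \<open>C m\<close> is contained in \<open>C n\<close>, the midpoint lies in
      \<open>C n\<close> and its squared norm is at least \<open>d n\<close>.\<close>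
    have "(1/2) *\<^sub>R x n + (1/2) *\<^sub>R x m \<in> C n"
      using xC[of n] subsetD[OF dec[OF that] xC[of m]] by (intro convexD[OF cv]) auto
    then have "d n \<le> (norm ((1/2) *\<^sub>R x n + (1/2) *\<^sub>R x m))\<^sup>2" by (rule d_le)
    also have "\<dots> = (norm (x n))\<^sup>2 / 2 + (norm (x m))\<^sup>2 / 2 - (dist (x n) (x m))\<^sup>2 / 4"
      by (simp add: power2_norm_eq_inner dist_norm inner_commute inner_add_left inner_add_right
          inner_diff_left inner_diff_right field_simps)
    finally have "(dist (x n) (x m))\<^sup>2 \<le> 2 * (norm (x n))\<^sup>2 + 2 * (norm (x m))\<^sup>2 - 4 * d n" by simp
    moreover have "1 / real (Suc m) \<le> 1 / real (Suc n)" using that by (intro divide_left_mono) auto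
    ultimately have "(dist (x n) (x m))\<^sup>2 \<le> 2 * (D - d n) + 4 * r" if "r = 1 / real (Suc n)" for r
      using xd[of n, folded that] xd[of m] D(2)[of m] unfolding that[symmetric] by argo
    from this[OF refl] show ?thesis by simp
  qed
  have "(\<lambda>n. 2 * (D - d n) + 4 * (1 / real (Suc n))) \<longlonglongrightarrow> 2 * (D - D) + 4 * 0"
    using D(1) LIMSEQ_Suc[OF lim_1_over_n] by (intro tendsto_intros) auto
  then have lim: "(\<lambda>n. 2 * (D - d n) + 4 / real (Suc n)) \<longlonglongrightarrow> 0" by simp
  have "Cauchy x"
  proof (rule metric_CauchyI)
    fix e :: real assume "e > 0"
    then have "eventually (\<lambda>n. 2 * (D - d n) + 4 / real (Suc n) < (e/2)\<^sup>2) sequentially"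
      by (intro order_tendstoD(2)[OF lim]) simp
    then obtain M where M: "2 * (D - d M) + 4 / real (Suc M) < (e/2)\<^sup>2"
      unfolding eventually_sequentially by blast
    have M': "dist (x m) (x M) < e / 2" if "m \<ge> M" for m
      using dist[OF that] M \<open>e > 0\<close>
      by (intro power2_less_imp_less[of _ "e/2"]) (auto simp: dist_commute)
    show "\<exists>M. \<forall>m\<ge>M. \<forall>n\<ge>M. dist (x m) (x n) < e"
      using dist_triangle_half_l[OF M' M'] by blast
  qed
  then obtain p where p: "x \<longlonglongrightarrow> p" using Cauchy_convergent convergent_def by blast
  have "p \<in> C n" for n
  proof (rule closed_sequentially[OF cl _ LIMSEQ_ignore_initial_segment[OF p, of n]])
    show "x (k + n) \<in> C n" for k using xC[of "k + n"] dec[of n "k + n"] by auto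
  qed
  then show ?thesis by blast
qed

text \<open>Takes the place of extracting a weakly convergent subsequence.\<close>

lemma bounded_sequence_tail_hull_point:
  fixes x :: "nat \<Rightarrow> 'a::{real_inner, complete_space}"
  assumes "bounded (range x)"
  shows "\<exists>p. \<forall>n. p \<in> closure (convex hull (x ` {n..}))"
proof (rule nested_closed_convex_Int_nonempty)
  show "closure (convex hull (x ` {n..})) \<subseteq> closure (convex hull (x ` {m..}))" if "m \<le> n" for m n
    using that by (intro closure_mono hull_mono image_mono) auto
  have "x ` {0..} = range x" by auto
  then show "bounded (closure (convex hull (x ` {0..})))"
    using assms by (simp add: bounded_convex_hull bounded_closure)
qed (auto simp: convex_closure)

section \<open>Points common to all closed convex hulls of tails\<close>

lemma closure_convex_hull_inner_ge:
  assumes "\<And>x. x \<in> S \<Longrightarrow> r \<le> x \<bullet> h" and q: "q \<in> closure (convex hull S)"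
  shows "r \<le> q \<bullet> h"
proof -
  have "closure (convex hull S) \<subseteq> {x. r \<le> x \<bullet> h}"
  proof (intro closure_minimal hull_minimal)
    show "closed {x. r \<le> x \<bullet> h}" by (intro closed_Collect_le continuous_intros)
    show "convex {x. r \<le> x \<bullet> h}" using convex_halfspace_ge[of r h] by (simp add: inner_commute)
  qed (use assms(1) in auto)
  then show ?thesis using q by auto
qed

definition tail_hull_point :: "(real \<Rightarrow> 'a::real_normed_vector) \<Rightarrow> 'a \<Rightarrow> bool" where
  "tail_hull_point y q \<longleftrightarrow> (\<forall>T. q \<in> closure (convex hull (y ` {T..})))"

lemma tail_hull_point_inner_ge:
  assumes "tail_hull_point y q" "\<forall>\<^sub>F t in at_top. r \<le> y t \<bullet> h"
  shows "r \<le> q \<bullet> h"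
proof -
  obtain T where "\<And>t. t \<ge> T \<Longrightarrow> r \<le> y t \<bullet> h"
    using assms(2) unfolding eventually_at_top_linorder by blast
  then have "\<And>x. x \<in> y ` {T..} \<Longrightarrow> r \<le> x \<bullet> h" by auto
  moreover have "q \<in> closure (convex hull (y ` {T..}))"
    using assms(1) unfolding tail_hull_point_def by blast
  ultimately show ?thesis by (rule closure_convex_hull_inner_ge)
qed

text \<open>Eventual bounds on \<open>y t \<bullet> h\<close> pass to \<open>q\<close> through
  closed half spaces; using the normals \<open>h\<close> and \<open>- h\<close> pins the value from
  both sides.\<close>

lemma tail_hull_point_inner_limit:
  assumes q: "tail_hull_point y q" and lim: "((\<lambda>t. y t \<bullet> h) \<longlongrightarrow> c) at_top"
  shows "q \<bullet> h = c"
proof (rule antisym)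
  have ge: "c \<le> q \<bullet> h" if "((\<lambda>t. y t \<bullet> h) \<longlongrightarrow> c) at_top" for c h
  proof (rule dense_le)
    fix r assume "r < c"
    from order_tendstoD(1)[OF that this] show "r \<le> q \<bullet> h"
      by (intro tail_hull_point_inner_ge[OF q]) (auto elim: eventually_mono)
  qed
  show "c \<le> q \<bullet> h" by (rule ge[OF lim])
  have "((\<lambda>t. y t \<bullet> (- h)) \<longlongrightarrow> - c) at_top" using tendsto_minus[OF lim] by simp
  from ge[OF this] show "q \<bullet> h \<le> c" by simp
qed

text \<open>The bound on \<open>s\<close> drives the sampling times past every \<open>T\<close>, so
  hulls of sampled tails lie in hulls of tails of \<open>y\<close>. The second conjunct retains the
  samples: an inequality valid only along \<open>s\<close> passes to \<open>q\<close>.\<close>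

lemma tail_hull_point_sequence:
  fixes y :: "real \<Rightarrow> 'a::{real_inner, complete_space}"
  assumes bd: "bounded (y ` {t0..})" and s: "\<And>k::nat. s k \<ge> t0 + real k"
  shows "\<exists>q. tail_hull_point y q \<and> (\<forall>n. q \<in> closure (convex hull ((\<lambda>k. y (s k)) ` {n..})))"
proof -
  have "s k \<ge> t0" for k using s[of k] by (meson le_add_same_cancel1 of_nat_0_le_iff order_trans)
  then have "bounded (range (\<lambda>k. y (s k)))" by (intro bounded_subset[OF bd]) auto
  then obtain q where q: "\<And>n. q \<in> closure (convex hull ((\<lambda>k. y (s k)) ` {n..}))"
    using bounded_sequence_tail_hull_point by blast
  have "q \<in> closure (convex hull (y ` {T..}))" for T
  proof -
    obtain n :: nat where n: "T - t0 \<le> real n" using real_arch_simple by blast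
    have "s k \<ge> T" if "k \<ge> n" for k
    proof -
      have "real k \<ge> real n" using that by simp
      then show ?thesis using s[of k] n by linarith
    qed
    then have "(\<lambda>k. y (s k)) ` {n..} \<subseteq> y ` {T..}" by auto
    then show ?thesis using q[of n] closure_mono[OF hull_mono] by blast
  qed
  then show ?thesis using q unfolding tail_hull_point_def by blast
qed

text \<open>Opial's argument. Points of all the closed convex hulls of tails of the trajectory replace
  weak cluster points, which avoids weak compactness.\<close>

lemma weakly_tendsto_Opial:
  fixes y :: "real \<Rightarrow> 'a::{real_inner, complete_space}"
  assumes bd: "bounded (y ` {t0..})"
    and Z: "\<And>q. tail_hull_point y q \<Longrightarrow> q \<in> Z"
    and conv: "\<And>z. z \<in> Z \<Longrightarrow> \<exists>l. ((\<lambda>t. norm (y t - z)) \<longlongrightarrow> l) at_top"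
  shows "\<exists>z\<in>Z. weakly_tendsto y z at_top"
proof -
  have uniq: "p = q" if p: "tail_hull_point y p" and q: "tail_hull_point y q" for p q
  proof -
    obtain k l where kl: "((\<lambda>t. norm (y t - p)) \<longlongrightarrow> k) at_top" "((\<lambda>t. norm (y t - q)) \<longlongrightarrow> l) at_top"
      using conv Z p q by blast
    \<comment> \<open>By this identity \<open>y t \<bullet> (p - q)\<close> converges, so
      \<open>p\<close> and \<open>q\<close>, both tail hull points, have the same inner product with
      \<open>p - q\<close>.\<close>
    have "y t \<bullet> (p - q) = ((norm (y t - q))\<^sup>2 - (norm (y t - p))\<^sup>2 + p \<bullet> p - q \<bullet> q) / 2" for t
      by (simp add: power2_norm_eq_inner algebra_simps inner_commute)
    moreover have "((\<lambda>t. ((norm (y t - q))\<^sup>2 - (norm (y t - p))\<^sup>2 + p \<bullet> p - q \<bullet> q) / 2)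
        \<longlongrightarrow> (l\<^sup>2 - k\<^sup>2 + p \<bullet> p - q \<bullet> q) / 2) at_top"
      using kl by (intro tendsto_intros) auto
    ultimately have "((\<lambda>t. y t \<bullet> (p - q)) \<longlongrightarrow> (l\<^sup>2 - k\<^sup>2 + p \<bullet> p - q \<bullet> q) / 2) at_top"
      by (simp only:)
    then have "p \<bullet> (p - q) = q \<bullet> (p - q)"
      using tail_hull_point_inner_limit p q by metis
    then have "(p - q) \<bullet> (p - q) = 0" by (simp add: inner_diff_left)
    then show ?thesis by simp
  qed
  obtain p where p: "tail_hull_point y p"
    using tail_hull_point_sequence[OF bd, of "\<lambda>k. t0 + real k"] by auto
  \<comment> \<open>Sampling the trajectory at times of large deviation would produce a tail hull
    point that differs from \<open>p\<close>.\<close>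
  have no: "\<not> (\<exists>\<^sub>F t in at_top. p \<bullet> h + e \<le> y t \<bullet> h)" if "e > 0" for h e
  proof
    assume fr: "\<exists>\<^sub>F t in at_top. p \<bullet> h + e \<le> y t \<bullet> h"
    have "\<exists>t. t \<ge> t0 + real k \<and> p \<bullet> h + e \<le> y t \<bullet> h" for k :: nat
    proof -
      have "\<exists>\<^sub>F t in at_top. p \<bullet> h + e \<le> y t \<bullet> h \<and> t \<ge> t0 + real k"
        by (rule frequently_eventually_frequently[OF fr eventually_ge_at_top])
      then show ?thesis using frequently_ex by blast
    qed
    then obtain s where s: "\<And>k. s k \<ge> t0 + real k" "\<And>k. p \<bullet> h + e \<le> y (s k) \<bullet> h" by metis
    obtain q where q: "tail_hull_point y q" "q \<in> closure (convex hull ((\<lambda>k. y (s k)) ` {0..}))"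
      using tail_hull_point_sequence[OF bd s(1)] by blast
    have "p \<bullet> h + e \<le> q \<bullet> h"
      by (rule closure_convex_hull_inner_ge[OF _ q(2)]) (use s(2) in auto)
    then show False using uniq[OF p q(1)] \<open>e > 0\<close> by simp
  qed
  have "((\<lambda>t. y t \<bullet> h) \<longlongrightarrow> p \<bullet> h) at_top" for h
  proof (rule order_tendstoI)
    fix r assume "p \<bullet> h < r"
    then show "\<forall>\<^sub>F t in at_top. y t \<bullet> h < r"
      using no[of "r - p \<bullet> h" h] by (simp add: not_frequently not_le)
  next
    fix r assume "r < p \<bullet> h"
    then show "\<forall>\<^sub>F t in at_top. r < y t \<bullet> h"
      using no[of "p \<bullet> h - r" "- h"] by (simp add: not_frequently not_le)
  qed
  then show ?thesis using Z[OF p] unfolding weakly_tendsto_def by blast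
qed

text \<open>Minty's trick: test the inequality at \<open>q - s *\<^sub>R V q\<close>, divide by
  \<open>s > 0\<close>, and let \<open>s\<close> tend to 0 using continuity.\<close>

lemma monotone_operator_zeroI:
  fixes V :: "'a::real_inner \<Rightarrow> 'a"
  assumes cont: "continuous_on UNIV V" and q: "\<And>x. 0 \<le> V x \<bullet> (x - q)"
  shows "V q = 0"
proof -
  let ?x = "\<lambda>s::real. q - s *\<^sub>R V q"
  have "((\<lambda>s. V (?x s)) \<longlongrightarrow> V (?x 0)) (at_right 0)"
    using cont by (intro continuous_on_tendsto_compose[OF cont]) (auto intro!: tendsto_eq_intros)
  then have "((\<lambda>s. V (?x s) \<bullet> V q) \<longlongrightarrow> V q \<bullet> V q) (at_right 0)"
    by (auto intro!: tendsto_intros)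
  moreover have "V (?x s) \<bullet> V q \<le> 0" if "s > 0" for s
  proof -
    have "0 \<le> - s * (V (?x s) \<bullet> V q)" using q[of "?x s"] by simp
    then show ?thesis using that by (simp add: mult_le_0_iff)
  qed
  then have "\<forall>\<^sub>F s in at_right 0. V (?x s) \<bullet> V q \<le> 0"
    by (auto simp: eventually_at_right_less eventually_at_filter)
  ultimately have "V q \<bullet> V q \<le> 0" by (intro tendsto_upperbound) auto
  then show ?thesis using inner_ge_zero[of "V q"] by (metis antisym inner_eq_zero_iff)
qed

text \<open>By monotonicity \<open>V x \<bullet> (x - y t)\<close> is at least
  \<open>V (y t) \<bullet> (x - y t)\<close>, which vanishes in the limit. The former is affine in
  \<open>y t\<close>, so nonnegativity passes to \<open>q\<close>.\<close>

lemma tail_hull_point_zero: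
  fixes V :: "'a::real_inner \<Rightarrow> 'a"
  assumes V: "monotone_operator V" "continuous_on UNIV V"
    and bd: "bounded (y ` {t0..})" and lim: "((\<lambda>t. norm (V (y t))) \<longlongrightarrow> 0) at_top"
    and q: "tail_hull_point y q"
  shows "V q = 0"
proof (rule monotone_operator_zeroI[OF V(2)])
  fix x
  obtain B where B: "\<And>t. t \<ge> t0 \<Longrightarrow> norm (y t) \<le> B" using bd by (auto simp: bounded_iff)
  have ev: "\<forall>\<^sub>F t in at_top. norm ((x - y t) \<bullet> V (y t)) \<le> norm (V (y t)) * (norm x + B)"
    using eventually_ge_at_top[of t0]
  proof eventually_elim
    case (elim t)
    have "norm (x - y t) \<le> norm x + B" using norm_triangle_ineq4[of x "y t"] B[OF elim] by simp
    then show ?case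
      using Cauchy_Schwarz_ineq2[of "x - y t" "V (y t)"] mult_right_mono[of _ _ "norm (V (y t))"]
      by (fastforce simp: mult.commute intro: order_trans)
  qed
  have lim0: "((\<lambda>t. (x - y t) \<bullet> V (y t)) \<longlongrightarrow> 0) at_top"
    by (rule Lim_null_comparison[OF ev]) (use lim in \<open>auto intro: tendsto_eq_intros\<close>)
  have "q \<bullet> V x \<le> x \<bullet> V x + e" if "e > 0" for e
  proof -
    have "- e < 0" using \<open>e > 0\<close> by simp
    with lim0 have "\<forall>\<^sub>F t in at_top. - e < (x - y t) \<bullet> V (y t)" by (rule order_tendstoD(1))
    \<comment> \<open>Rewritten as a half space with normal \<open>- V x\<close>, the form to which
      tail hull points respond.\<close>
    then have "\<forall>\<^sub>F t in at_top. - (x \<bullet> V x + e) \<le> y t \<bullet> (- V x)"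
    proof eventually_elim
      case (elim t)
      have "0 \<le> (V x - V (y t)) \<bullet> (x - y t)" using V(1) by (auto simp: monotone_operator_def)
      then show ?case using elim by (simp add: inner_commute algebra_simps)
    qed
    from tail_hull_point_inner_ge[OF q this] show ?thesis by simp
  qed
  then have "q \<bullet> V x \<le> x \<bullet> V x" by (rule field_le_epsilon)
  then show "0 \<le> V x \<bullet> (x - q)" by (simp add: inner_commute algebra_simps)
qed

subsection \<open>The dynamical system\<close>

text \<open>Only times after \<open>t\<close> are used, so \<open>t = t0\<close> needs no separate
  case.\<close>

lemma has_vector_derivative_slope_right:
  assumes f: "(f has_vector_derivative d) (at t within {t0..})" and t: "t0 \<le> t"
  shows "((\<lambda>s. (f s - f t) /\<^sub>R (s - t)) \<longlongrightarrow> d) (at_right t)"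
proof -
  have "(f has_vector_derivative d) (at_right t)"
    by (rule has_vector_derivative_within_subset[OF f]) (use t in auto)
  then have "((\<lambda>s. ((f s - f t) - (s - t) *\<^sub>R d) /\<^sub>R norm (s - t)) \<longlongrightarrow> 0) (at_right t)"
    unfolding has_vector_derivative_def has_derivative_at_within by blast
  moreover have "\<forall>\<^sub>F s in at_right t.
      ((f s - f t) - (s - t) *\<^sub>R d) /\<^sub>R norm (s - t) = (f s - f t) /\<^sub>R (s - t) - d"
    using eventually_at_right_less[of t] by eventually_elim (simp add: scaleR_diff_right)
  ultimately have "((\<lambda>s. (f s - f t) /\<^sub>R (s - t) - d) \<longlongrightarrow> 0) (at_right t)"
    by (rule Lim_transform_eventually)
  then show ?thesis by (rule LIM_zero_cancel)
qed

text \<open>Monotonicity makes the inner product of the difference quotients of \<open>y\<close> and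
  of \<open>V\<close> along \<open>y\<close> nonnegative, and the sign survives the limit.\<close>

lemma monotone_operator_derivative_inner_nonneg:
  fixes y :: "real \<Rightarrow> 'a::real_inner"
  assumes V: "monotone_operator V"
    and y: "(y has_vector_derivative v) (at t within {t0..})"
    and W: "((\<lambda>s. V (y s)) has_vector_derivative b) (at t within {t0..})"
    and t: "t0 \<le> t"
  shows "0 \<le> v \<bullet> b"
proof (rule tendsto_lowerbound)
  show "((\<lambda>s. ((y s - y t) /\<^sub>R (s - t)) \<bullet> ((V (y s) - V (y t)) /\<^sub>R (s - t))) \<longlongrightarrow> v \<bullet> b) (at_right t)"
    by (intro tendsto_inner has_vector_derivative_slope_right[OF y t]
        has_vector_derivative_slope_right[OF W t])
  have "0 \<le> (y s - y t) \<bullet> (V (y s) - V (y t))" for s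
    using V by (simp add: monotone_operator_def inner_commute)
  then show "\<forall>\<^sub>F s in at_right t. 0 \<le> ((y s - y t) /\<^sub>R (s - t)) \<bullet> ((V (y s) - V (y t)) /\<^sub>R (s - t))"
    using eventually_at_right_less[of t] by (auto elim!: eventually_mono)
qed simp

theorem theorem4p3:
  fixes V :: "'a::{real_inner, complete_space} \<Rightarrow> 'a"
    and xs :: 'a
    and t0 lam L :: real
    and \<mu> \<gamma> :: "real \<Rightarrow> real"
    and y :: "real \<Rightarrow> 'a"
  assumes "monotone_operator V"
    and "continuous_on UNIV V"
    and "V xs = 0"
    and "t0 > 0"
    and "lam > 0"
    and "\<And>t. t \<ge> t0 \<Longrightarrow> \<mu> t > 0"
    and "C1_from t0 \<mu>"
    and "mono_on {t0..} \<mu>"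
    and "\<And>t. t \<ge> t0 \<Longrightarrow> \<gamma> t > 0"
    and "continuous_on {t0..} \<gamma>"
    and "((\<lambda>t. \<gamma> t / \<mu> t) \<longlongrightarrow> L) at_top"
    and "L > 0"
    and "(SUP t\<in>{t0..}. ereal (deriv_from t0 \<mu> t / \<gamma> t)) < 1"
    and "ereal (2 * lam - 3 * L) + (INF t\<in>{t0..}. ereal (deriv_from t0 \<mu> t / \<mu> t)) > 0"
    and "is_solution V t0 lam \<mu> \<gamma> y"
  shows "((\<lambda>t. norm (V (y t))) \<in> o[at_top](\<lambda>t. 1 / \<mu> t)
        \<and> (\<lambda>t. (y t - xs) \<bullet> V (y t)) \<in> o[at_top](\<lambda>t. 1 / \<mu> t)
        \<and> ((\<lambda>t. norm (deriv_from t0 y t)) \<longlongrightarrow> 0) at_top)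
       \<and> (\<exists>z. V z = 0 \<and> weakly_tendsto y z at_top)"
proof -
  note V = assms(1,2) and xs = assms(3) and lam = assms(5) and \<mu>pos = assms(6)
    and \<mu>C1 = assms(7) and \<mu>mono = assms(8) and \<gamma>pos = assms(9) and L = assms(11,12)
  let ?v = "deriv_from t0 y" and ?W = "\<lambda>t. V (y t)"
  have yd: "(y has_vector_derivative ?v t) (at t within {t0..})" if "t0 \<le> t" for t
    using assms(15) that by (simp add: is_solution_def deriv_from_def flip: vector_derivative_works)
  have AC: "absolutely_continuous_on {t0..t} y" "absolutely_continuous_on {t0..t} ?v"
    "absolutely_continuous_on {t0..t} ?W" if "t0 \<le> t" for t
    using assms(15) that by (auto simp: is_solution_def)
  have \<mu>AC: "absolutely_continuous_on {t0..t} \<mu>" for t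
    by (rule C1_from_imp_absolutely_continuous_on[OF \<mu>C1 order_refl])
  have \<mu>d: "(\<mu> has_real_derivative deriv_from t0 \<mu> t) (at t within {t0..})" if "t0 \<le> t" for t
    using \<mu>C1 that
    by (simp add: C1_from_def deriv_from_def has_real_derivative_iff_has_vector_derivative
        flip: vector_derivative_works)
  have "AE t in lebesgue. t \<ge> t0 \<longrightarrow>
      (\<exists>a b. (?v has_vector_derivative a) (at t within {t0..})
           \<and> (?W has_vector_derivative b) (at t within {t0..})
           \<and> a + lam *\<^sub>R ?v t + \<mu> t *\<^sub>R b + \<gamma> t *\<^sub>R ?W t = 0)"
    using assms(15) unfolding is_solution_def by blast
  from AE_E3[OF this] obtain N where N: "N \<in> null_sets lebesgue"
    and ode: "\<And>t. t \<in> space lebesgue - N \<Longrightarrow> t \<ge> t0 \<longrightarrow>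
      (\<exists>a b. (?v has_vector_derivative a) (at t within {t0..})
           \<and> (?W has_vector_derivative b) (at t within {t0..})
           \<and> a + lam *\<^sub>R ?v t + \<mu> t *\<^sub>R b + \<gamma> t *\<^sub>R ?W t = 0)"
    by blast
  have ode': "\<exists>a b. (?v has_vector_derivative a) (at t within {t0..})
      \<and> (?W has_vector_derivative b) (at t within {t0..}) \<and> 0 \<le> ?v t \<bullet> b
      \<and> a + lam *\<^sub>R ?v t + \<mu> t *\<^sub>R b + \<gamma> t *\<^sub>R ?W t = 0" if t: "t0 \<le> t" "t \<notin> N" for t
  proof -
    obtain a b where ab: "(?v has_vector_derivative a) (at t within {t0..})"
      "(?W has_vector_derivative b) (at t within {t0..})"
      "a + lam *\<^sub>R ?v t + \<mu> t *\<^sub>R b + \<gamma> t *\<^sub>R ?W t = 0"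
      using ode[of t] t by auto
    moreover have "0 \<le> ?v t \<bullet> b"
      by (rule monotone_operator_derivative_inner_nonneg[OF V(1) yd[OF t(1)] ab(2) t(1)])
    ultimately show ?thesis by blast
  qed
  \<comment> \<open>A real number strictly between the supremum and 1 turns the extended real
    hypothesis into a uniform real bound; \<open>r2\<close> below does the same for the
    infimum.\<close>
  obtain r1 where r1: "(SUP t\<in>{t0..}. ereal (deriv_from t0 \<mu> t / \<gamma> t)) < ereal r1" "ereal r1 < 1"
    using ereal_dense2[OF assms(13)] by blast
  have r1_le: "deriv_from t0 \<mu> t / \<gamma> t \<le> r1" if "t0 \<le> t" for t
  proof -
    have "ereal (deriv_from t0 \<mu> t / \<gamma> t) \<le> (SUP t\<in>{t0..}. ereal (deriv_from t0 \<mu> t / \<gamma> t))"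
      using that by (intro SUP_upper) simp
    from le_less_trans[OF this r1(1)] show ?thesis by simp
  qed
  have "ereal (3 * L - 2 * lam) < (INF t\<in>{t0..}. ereal (deriv_from t0 \<mu> t / \<mu> t))"
    using assms(14) by (cases "INF t\<in>{t0..}. ereal (deriv_from t0 \<mu> t / \<mu> t)") auto
  then obtain r2 where r2: "ereal (3 * L - 2 * lam) < ereal r2"
    "ereal r2 < (INF t\<in>{t0..}. ereal (deriv_from t0 \<mu> t / \<mu> t))"
    using ereal_dense2 by blast
  have r2_le: "r2 \<le> deriv_from t0 \<mu> t / \<mu> t" if "t0 \<le> t" for t
  proof -
    have "(INF t\<in>{t0..}. ereal (deriv_from t0 \<mu> t / \<mu> t)) \<le> ereal (deriv_from t0 \<mu> t / \<mu> t)"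
      using that by (intro INF_lower) simp
    from less_le_trans[OF r2(2) this] show ?thesis by simp
  qed
  have r: "r1 < 1" "3 * L - 2 * lam < r2" using r1(2) r2(1) by (simp_all add: one_ereal_def)
  \<comment> \<open>Needed for every zero \<open>p\<close>: the point \<open>xs\<close> gives the
    decay rates, and Opial's argument uses convergence of the distance to each zero.\<close>
  have lims: "((\<lambda>t. norm (?v t)) \<longlongrightarrow> 0) at_top" "((\<lambda>t. norm (\<mu> t *\<^sub>R ?W t)) \<longlongrightarrow> 0) at_top"
      "((\<lambda>t. (y t - p) \<bullet> (\<mu> t *\<^sub>R ?W t)) \<longlongrightarrow> 0) at_top"
      "\<exists>l. ((\<lambda>t. norm (y t - p)) \<longlongrightarrow> l) at_top"
    if p: "V p = 0" for p
  proof -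
    have zd: "((\<lambda>t. y t - p) has_vector_derivative ?v t) (at t within {t0..})" if "t0 \<le> t" for t
      using has_vector_derivative_diff[OF yd[OF that] has_vector_derivative_const[of p]] by simp
    have zW: "0 \<le> (y t - p) \<bullet> ?W t" for t
      using V(1) p unfolding monotone_operator_def by (metis diff_zero inner_commute)
    note * = trajectory_limits[OF zd absolutely_continuous_on_diff_const[OF AC(1)] AC(2,3) \<mu>AC \<mu>d
        \<mu>pos \<gamma>pos zW N ode' L lam r(1) r1_le r(2) r2_le]
    show "((\<lambda>t. norm (?v t)) \<longlongrightarrow> 0) at_top" "((\<lambda>t. norm (\<mu> t *\<^sub>R ?W t)) \<longlongrightarrow> 0) at_top"
      "((\<lambda>t. (y t - p) \<bullet> (\<mu> t *\<^sub>R ?W t)) \<longlongrightarrow> 0) at_top"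
      "\<exists>l. ((\<lambda>t. norm (y t - p)) \<longlongrightarrow> l) at_top"
      using * by simp_all
  qed
  have \<mu>ev: "\<forall>\<^sub>F t in at_top. 0 < \<mu> t"
    using eventually_ge_at_top[of t0] by eventually_elim (rule \<mu>pos)
  have smallo: "f \<in> o[at_top](\<lambda>t. 1 / \<mu> t)" if f: "((\<lambda>t. \<mu> t * f t) \<longlongrightarrow> 0) at_top" for f :: "real \<Rightarrow> real"
  proof (rule smalloI_tendsto)
    show "((\<lambda>t. f t / (1 / \<mu> t)) \<longlongrightarrow> 0) at_top" using f by (simp add: mult.commute)
    show "\<forall>\<^sub>F t in at_top. 1 / \<mu> t \<noteq> 0" using \<mu>ev by eventually_elim simp
  qed
  have W0: "((\<lambda>t. \<mu> t * norm (?W t)) \<longlongrightarrow> 0) at_top"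
    by (rule Lim_transform_eventually[OF lims(2)[OF xs]]) (use \<mu>ev in \<open>auto elim: eventually_mono\<close>)
  have "(\<lambda>t. norm (?W t)) \<in> o[at_top](\<lambda>t. 1 / \<mu> t)" by (rule smallo[OF W0])
  moreover have "(\<lambda>t. (y t - xs) \<bullet> ?W t) \<in> o[at_top](\<lambda>t. 1 / \<mu> t)"
    using lims(3)[OF xs] by (intro smallo) simp
  moreover note lims(1)[OF xs]
  moreover have "\<exists>z. V z = 0 \<and> weakly_tendsto y z at_top"
  proof -
    \<comment> \<open>\<open>\<mu>\<close> need not be unbounded; being nondecreasing it stays above
      \<open>\<mu> t0 > 0\<close>, which suffices.\<close>
    have "((\<lambda>t. norm (?W t)) \<longlongrightarrow> 0) at_top"
    proof (rule Lim_null_comparison)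
      show "\<forall>\<^sub>F t in at_top. norm (norm (?W t)) \<le> (\<mu> t * norm (?W t)) / \<mu> t0"
        using eventually_ge_at_top[of t0]
      proof eventually_elim
        case (elim t)
        have "\<mu> t0 \<le> \<mu> t" using \<mu>mono elim by (auto simp: mono_on_def)
        then have "\<mu> t0 * norm (?W t) \<le> \<mu> t * norm (?W t)" by (rule mult_right_mono) simp
        then show ?case using \<mu>pos[of t0] by (simp add: pos_le_divide_eq mult.commute)
      qed
      show "((\<lambda>t. (\<mu> t * norm (?W t)) / \<mu> t0) \<longlongrightarrow> 0) at_top"
        using tendsto_divide[OF W0 tendsto_const[of "\<mu> t0"]] \<mu>pos[of t0] by simp
    qed
    note W_lim = this
    obtain l where "((\<lambda>t. norm (y t - xs)) \<longlongrightarrow> l) at_top" using lims(4)[OF xs] by blast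
    then have "\<forall>\<^sub>F t in at_top. norm (y t - xs) < l + 1" by (rule order_tendstoD(2)) simp
    then obtain T where T: "\<And>t. T \<le> t \<Longrightarrow> norm (y t - xs) < l + 1"
      unfolding eventually_at_top_linorder by blast
    \<comment> \<open>Convergence of the distance bounds \<open>y\<close> only from some time
      \<open>T\<close> on, so Opial's argument starts at \<open>T\<close>.\<close>
    have bd: "bounded (y ` {T..})"
    proof (rule boundedI)
      fix x assume "x \<in> y ` {T..}"
      then obtain t where "x = y t" "T \<le> t" by auto
      then show "norm x \<le> norm xs + (l + 1)"
        using T[of t] norm_triangle_ineq[of xs "y t - xs"] by simp
    qed
    have "\<exists>z\<in>{z. V z = 0}. weakly_tendsto y z at_top"
      by (rule weakly_tendsto_Opial[OF bd]) (use tail_hull_point_zero[OF V bd W_lim] lims(4) in auto)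
    then show ?thesis by blast
  qed
  ultimately show ?thesis by blast
qed

end
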